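(* For every $\eta>0$, every configuration $\mathcal{H}$ and every $m\in\mathbb{N}$ with $m>|\mathcal{H}|$, there are $J,n_0\in\mathbb{N}$ such that if $\mathcal{F}\subset[m]^n$ is $\mathcal{H}$-free with $n\ge n_0$, then there is an $\mathcal{H}$-free $J$-junta $\mathcal{J}\subset[m]^n$ such that $\mu(\mathcal{F}\setminus\mathcal{J})\le\eta$.
   Context: $\mu$ is the uniform probability measure on $[m]^n$. An $\ell$-configuration is a pair $(\mathcal{H},(U_1,\dots,U_\ell))$ where $\mathcal{H}=\{e_1,\dots,e_h\}$ is a multiset of $\ell$-element subsets (edges) of a finite vertex set partitioned into $U_1,\dots,U_\ell$, each edge having exactly one vertex in each part; its size is $|\mathcal{H}|=h$. A family $\mathcal{F}\subset[m]^n$ contains $\mathcal{H}$ if there are $x^1,\dots,x^h\in\mathcal{F}$ and an injection $\Phi:[\ell]\to[n]$ such that for all distinct $j,j'\in[h]$ and all $i\in[n]$: $x^j_i=x^{j'}_i$ holds exactly when $i=\Phi(k)$ for some $k\in[\ell]$ with $e_j\cap e_{j'}\cap U_k\neq\emptyset$; otherwise $\mathcal{F}$ is $\mathcal{H}$-free. A $J$-junta is a family of the form $\{x\in[m]^n:x_I\in\mathcal{A}\}$ with $|I|=J$ and $\mathcal{A}\subset[m]^I$. *)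

theory Defs
  imports Complex_Main "HOL-Library.FuncSet"
begin

definition cube :: "nat \<Rightarrow> nat \<Rightarrow> (nat \<Rightarrow> nat) set" where
  "cube m n = PiE {0..<n} (\<lambda>_. {0..<m})"

definition mu :: "nat \<Rightarrow> nat \<Rightarrow> (nat \<Rightarrow> nat) set \<Rightarrow> real" where
  "mu m n S = real (card (S \<inter> cube m n)) / real (card (cube m n))"

text \<open>An l-configuration with h edges (a multiset of edges) is encoded by a function
  E :: nat => nat => 'v : for j < h and k < l, E j k is the unique vertex of edge e_j
  lying in part U_k.  (Parts are disjoint, so vertices of different parts are
  distinct; thus e_j \<inter> e_j' \<inter> U_k \<noteq> {} iff E j k = E j' k.)\<close>

definition contains_config ::
  "nat \<Rightarrow> (nat \<Rightarrow> nat) set \<Rightarrow> nat \<Rightarrow> nat \<Rightarrow> (nat \<Rightarrow> nat \<Rightarrow> 'v) \<Rightarrow> bool" where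
  "contains_config n F l h E \<longleftrightarrow>
     (\<exists>x :: nat \<Rightarrow> nat \<Rightarrow> nat. \<exists>\<Phi> :: nat \<Rightarrow> nat.
        (\<forall>j<h. x j \<in> F) \<and>
        inj_on \<Phi> {0..<l} \<and> \<Phi> ` {0..<l} \<subseteq> {0..<n} \<and>
        (\<forall>j<h. \<forall>j'<h. j \<noteq> j' \<longrightarrow>
           (\<forall>i<n. (x j i = x j' i) \<longleftrightarrow> (\<exists>k<l. i = \<Phi> k \<and> E j k = E j' k))))"

definition config_free ::
  "nat \<Rightarrow> (nat \<Rightarrow> nat) set \<Rightarrow> nat \<Rightarrow> nat \<Rightarrow> (nat \<Rightarrow> nat \<Rightarrow> 'v) \<Rightarrow> bool" where
  "config_free n F l h E \<longleftrightarrow> \<not> contains_config n F l h E"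

definition is_junta :: "nat \<Rightarrow> nat \<Rightarrow> nat \<Rightarrow> (nat \<Rightarrow> nat) set \<Rightarrow> bool" where
  "is_junta m n J S \<longleftrightarrow>
     (\<exists>I A. I \<subseteq> {0..<n} \<and> card I = J \<and> A \<subseteq> PiE I (\<lambda>_. {0..<m}) \<and>
        S = {x \<in> cube m n. restrict x I \<in> A})"

end

theory Submission
  imports Defs "HOL-Library.Indicator_Function"
begin

text \<open>
  Call a subcube spread if \<open>F\<close> keeps density at least \<open>\<delta>\<close> in it after fixing any bounded number of further
  coordinates. Repeatedly splitting the subcubes that are not spread and discarding the pieces of density below
  \<open>\<delta>\<close> produces boundedly many coordinates \<open>I\<close> such that, up to measure \<open>\<eta>\<close>, \<open>F\<close> lives on spread subcubes
  over \<open>I\<close>; their union is the junta. It is free because a configuration in it lifts to \<open>F\<close>: after fixing the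
  centre of the configuration, one must choose from \<open>h\<close> spread families points that differ pairwise in every
  remaining coordinate.

  To find these points, give every family in every coordinate a set of one or (with probability \<open>p\<close>) two
  allowed letters, two-letter sets being neighbours in the cycle on \<open>[m]\<close>. The probability that the family meets
  the resulting box increases with \<open>p\<close>, so by Russo's formula and the mean value theorem the total influence
  is bounded at some \<open>p\<close>. By a log-Sobolev argument of Falik and Samorodnitsky the event is then nearly
  determined by boundedly many coordinates; spreadness bounds its conditional probability below by \<open>\<delta>\<close>, hence
  it is almost certain. As \<open>h < m\<close>, the random sets of the \<open>h\<close> families can be coupled to be disjoint in every
  coordinate, and a union bound concludes.
\<close>

section \<open>Averages over product spaces\<close>

text \<open>The result is again a function of the whole point, constant in coordinate
  \<open>i\<close>, so averages compose as operators and no product measure has to be built. Signed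
  weights such as \<open>pair_weight_deriv\<close> are allowed.\<close>

definition avg :: "'a set \<Rightarrow> ('a \<Rightarrow> real) \<Rightarrow> 'i \<Rightarrow> (('i \<Rightarrow> 'a) \<Rightarrow> real) \<Rightarrow> ('i \<Rightarrow> 'a) \<Rightarrow> real" where
  "avg \<Omega> w i f x = (\<Sum>a\<in>\<Omega>. w a * f (x(i := a)))"

text \<open>For finite \<open>S\<close> the order of the fold is immaterial since averages commute.
  Coordinates outside \<open>S\<close> are read from the argument, so for probability weights this
  is a conditional expectation given them.\<close>

definition expect :: "'a set \<Rightarrow> ('a \<Rightarrow> real) \<Rightarrow> 'i set \<Rightarrow> (('i \<Rightarrow> 'a) \<Rightarrow> real) \<Rightarrow> ('i \<Rightarrow> 'a) \<Rightarrow> real" where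
  "expect \<Omega> w S f = Finite_Set.fold (avg \<Omega> w) f S"

text \<open>Fubini for two coordinates. The weights may differ because differentiating an
  expectation replaces the weight of a single coordinate.\<close>

lemma avg_commute_weights:
  assumes "i \<noteq> j"
  shows "avg \<Omega> w i (avg \<Omega> w' j f) = avg \<Omega> w' j (avg \<Omega> w i f)"
proof
  fix x
  have "avg \<Omega> w i (avg \<Omega> w' j f) x = (\<Sum>a\<in>\<Omega>. \<Sum>b\<in>\<Omega>. w a * w' b * f (x(i := a, j := b)))"
    by (simp add: avg_def sum_distrib_left mult_ac)
  also have "\<dots> = (\<Sum>b\<in>\<Omega>. \<Sum>a\<in>\<Omega>. w a * w' b * f (x(j := b, i := a)))"
    by (subst sum.swap) (simp add: fun_upd_twist[OF assms])
  also have "\<dots> = avg \<Omega> w' j (avg \<Omega> w i f) x"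
    by (simp add: avg_def sum_distrib_left mult_ac)
  finally show "avg \<Omega> w i (avg \<Omega> w' j f) x = avg \<Omega> w' j (avg \<Omega> w i f) x" .
qed

lemma avg_commute: "avg \<Omega> w i (avg \<Omega> w j f) = avg \<Omega> w j (avg \<Omega> w i f)"
  by (cases "i = j") (auto intro: avg_commute_weights)

lemma comp_fun_commute_avg: "comp_fun_commute (avg \<Omega> w)"
  by unfold_locales (auto simp: fun_eq_iff avg_commute[of \<Omega> w])

lemma expect_empty [simp]: "expect \<Omega> w {} f = f"
  by (simp add: expect_def)

lemma expect_insert:
  assumes "finite S" "i \<notin> S"
  shows "expect \<Omega> w (insert i S) f = avg \<Omega> w i (expect \<Omega> w S f)"
proof -
  interpret comp_fun_commute "avg \<Omega> w" by (rule comp_fun_commute_avg)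
  show ?thesis unfolding expect_def using assms by (rule fold_insert)
qed

lemma avg_expect_weights:
  assumes "finite S" "i \<notin> S"
  shows "avg \<Omega> w' i (expect \<Omega> w S f) = expect \<Omega> w S (avg \<Omega> w' i f)"
  using assms
proof (induction S rule: finite_induct)
  case (insert k S)
  then show ?case by (simp add: expect_insert avg_commute_weights[of i k])
qed simp

lemma expect_upd:
  assumes "finite S" "i \<notin> S"
  shows "expect \<Omega> w S f (x(i := a)) = expect \<Omega> w S (\<lambda>y. f (y(i := a))) x"
  using assms
proof (induction S arbitrary: x rule: finite_induct)
  case (insert k S)
  then have "i \<noteq> k" by auto
  have "expect \<Omega> w S f (x(i := a, k := b)) = expect \<Omega> w S (\<lambda>y. f (y(i := a))) (x(k := b))" for b
    using insert.IH[of "x(k := b)"] insert.prems fun_upd_twist[OF \<open>i \<noteq> k\<close>, of x a b]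
    by (simp del: fun_upd_apply)
  with insert show ?case
    by (simp add: expect_insert avg_def del: fun_upd_apply)
qed simp

lemma avg_mono_on:
  assumes "\<And>a. a \<in> \<Omega> \<Longrightarrow> w a \<ge> 0" "\<And>a. a \<in> \<Omega> \<Longrightarrow> f (x(i := a)) \<le> g (x(i := a))"
  shows "avg \<Omega> w i f x \<le> avg \<Omega> w i g x"
  unfolding avg_def by (intro sum_mono mult_left_mono assms)

text \<open>The comparison is demanded only at points that agree with \<open>x\<close> off
  \<open>S\<close> and take values in \<Omega> on \<open>S\<close>; robustness yields bounds only at
  such points.\<close>

lemma expect_mono_on:
  assumes "finite S" "\<And>a. a \<in> \<Omega> \<Longrightarrow> w a \<ge> 0"
    and "\<And>y. (\<And>i. i \<notin> S \<Longrightarrow> y i = x i) \<Longrightarrow> (\<And>i. i \<in> S \<Longrightarrow> y i \<in> \<Omega>) \<Longrightarrow> f y \<le> g y"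
  shows "expect \<Omega> w S f x \<le> expect \<Omega> w S g x"
  using assms(1,3)
proof (induction S arbitrary: x rule: finite_induct)
  case empty
  then show ?case by simp
next
  case (insert i S)
  have "expect \<Omega> w S f (x(i := a)) \<le> expect \<Omega> w S g (x(i := a))" if "a \<in> \<Omega>" for a
  proof (rule insert.IH)
    fix y assume y: "\<And>k. k \<notin> S \<Longrightarrow> y k = (x(i := a)) k" "\<And>k. k \<in> S \<Longrightarrow> y k \<in> \<Omega>"
    show "f y \<le> g y"
      using y that \<open>i \<notin> S\<close> by (intro insert.prems) (auto split: if_splits)
  qed
  then show ?case
    using insert.hyps by (simp add: expect_insert avg_mono_on assms(2))
qed

lemma expect_mono:
  assumes "finite S" "\<And>a. a \<in> \<Omega> \<Longrightarrow> w a \<ge> 0" "\<And>y. f y \<le> g y"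
  shows "expect \<Omega> w S f x \<le> expect \<Omega> w S g x"
  using assms by (intro expect_mono_on) auto

lemma avg_linear:
  "avg \<Omega> w i (\<lambda>x. c * f x + d * g x) = (\<lambda>x. c * avg \<Omega> w i f x + d * avg \<Omega> w i g x)"
  by (simp add: avg_def fun_eq_iff algebra_simps sum.distrib sum_distrib_left)

lemma expect_linear:
  assumes "finite S"
  shows "expect \<Omega> w S (\<lambda>x. c * f x + d * g x) = (\<lambda>x. c * expect \<Omega> w S f x + d * expect \<Omega> w S g x)"
  using assms
proof (induction S rule: finite_induct)
  case (insert i S)
  then show ?case by (simp add: expect_insert avg_linear)
qed simp

lemma expect_add: "finite S \<Longrightarrow> expect \<Omega> w S (\<lambda>x. f x + g x) = (\<lambda>x. expect \<Omega> w S f x + expect \<Omega> w S g x)"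
  using expect_linear[of S \<Omega> w 1 f 1 g] by simp

lemma expect_diff: "finite S \<Longrightarrow> expect \<Omega> w S (\<lambda>x. f x - g x) = (\<lambda>x. expect \<Omega> w S f x - expect \<Omega> w S g x)"
  using expect_linear[of S \<Omega> w 1 f "-1" g] by simp

lemma expect_cmult: "finite S \<Longrightarrow> expect \<Omega> w S (\<lambda>x. c * f x) = (\<lambda>x. c * expect \<Omega> w S f x)"
  using expect_linear[of S \<Omega> w c f 0 f] by simp

lemma expect_sum:
  assumes "finite S"
  shows "expect \<Omega> w S (\<lambda>x. \<Sum>k\<in>K. f k x) = (\<lambda>x. \<Sum>k\<in>K. expect \<Omega> w S (f k) x)"
proof (induction K rule: infinite_finite_induct)
  case (insert k K)
  then show ?case using assms by (simp add: expect_add)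
qed (use expect_cmult[OF assms, of \<Omega> w 0 "\<lambda>_. 0"] in auto)

lemma avg_diff: "avg \<Omega> w i (\<lambda>x. f x - g x) = (\<lambda>x. avg \<Omega> w i f x - avg \<Omega> w i g x)"
  using avg_linear[of \<Omega> w i 1 f "-1" g] by simp

text \<open>General form of Russo's formula: by the product rule, each coordinate in turn has its
  weight replaced by the derivative of the weight.\<close>

lemma expect_derivative:
  assumes "finite S" and "(\<Sum>a\<in>\<Omega>. w p a) = 1"
    and "\<And>a. a \<in> \<Omega> \<Longrightarrow> ((\<lambda>p. w p a) has_real_derivative w' a) (at p)"
  shows "((\<lambda>p. expect \<Omega> (w p) S f x) has_real_derivative
          (\<Sum>i\<in>S. expect \<Omega> (w p) S (avg \<Omega> w' i f) x)) (at p)"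
  using assms(1)
proof (induction S arbitrary: x rule: finite_induct)
  case empty
  then show ?case by simp
next
  case (insert i S)
  let ?E = "\<lambda>p. expect \<Omega> (w p) S"
  have "((\<lambda>p. \<Sum>a\<in>\<Omega>. w p a * ?E p f (x(i := a))) has_real_derivative
      (\<Sum>a\<in>\<Omega>. w' a * ?E p f (x(i := a)) +
        (\<Sum>k\<in>S. ?E p (avg \<Omega> w' k f) (x(i := a))) * w p a)) (at p)"
    by (intro DERIV_sum DERIV_mult assms insert.IH)
  also have "(\<Sum>a\<in>\<Omega>. w' a * ?E p f (x(i := a)) + (\<Sum>k\<in>S. ?E p (avg \<Omega> w' k f) (x(i := a))) * w p a)
     = avg \<Omega> w' i (?E p f) x + (\<Sum>k\<in>S. avg \<Omega> (w p) i (?E p (avg \<Omega> w' k f)) x)"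
    unfolding avg_def[of \<Omega> w' i "?E p f"] avg_def[of \<Omega> "w p"] sum.distrib
    by (subst sum.swap) (simp add: sum_distrib_left mult_ac)
  also have "(\<Sum>k\<in>S. avg \<Omega> (w p) i (?E p (avg \<Omega> w' k f)) x) =
      (\<Sum>k\<in>S. expect \<Omega> (w p) (insert i S) (avg \<Omega> w' k f) x)"
    using insert.hyps by (simp add: expect_insert)
  \<comment> \<open>The left side no longer depends on coordinate \<open>i\<close>, so one more
    average over \<open>i\<close>, of total weight 1, can be inserted.\<close>
  also have "avg \<Omega> w' i (?E p f) x = expect \<Omega> (w p) (insert i S) (avg \<Omega> w' i f) x"
  proof -
    have "expect \<Omega> (w p) (insert i S) (avg \<Omega> w' i f) x = avg \<Omega> (w p) i (avg \<Omega> w' i (?E p f)) x"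
      using insert.hyps by (simp add: expect_insert avg_expect_weights)
    also have "\<dots> = (\<Sum>a\<in>\<Omega>. w p a) * avg \<Omega> w' i (?E p f) x"
      by (simp add: avg_def sum_distrib_right)
    finally show ?thesis by (simp add: assms)
  qed
  finally have D: "((\<lambda>p. \<Sum>a\<in>\<Omega>. w p a * ?E p f (x(i := a))) has_real_derivative
      (\<Sum>k\<in>insert i S. expect \<Omega> (w p) (insert i S) (avg \<Omega> w' k f) x)) (at p)"
    using insert.hyps by (simp del: fun_upd_apply)
  have "(\<lambda>p. expect \<Omega> (w p) (insert i S) f x) = (\<lambda>p. \<Sum>a\<in>\<Omega>. w p a * ?E p f (x(i := a)))"
    unfolding expect_insert[OF insert.hyps] by (simp add: avg_def del: fun_upd_apply)
  with D show ?case by simp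
qed

text \<open>Change of variables, coordinate by coordinate: summands are grouped by their image under
  \<open>\<pi>\<close>. It serves to forget the flags of pairs and to pass from the coupled arcs to
  the law of a single family.\<close>

lemma expect_pushforward:
  assumes "finite S" "finite \<Omega>'" "finite \<Omega>" "\<pi> ` \<Omega>' \<subseteq> \<Omega>"
    and "\<And>a. a \<in> \<Omega> \<Longrightarrow> (\<Sum>b\<in>{b\<in>\<Omega>'. \<pi> b = a}. w' b) = w a"
    and "\<And>s i b. i \<in> S \<Longrightarrow> \<psi> (s(i := b)) = (\<psi> s)(i := \<pi> b)"
  shows "expect \<Omega>' w' S (\<lambda>s. f (\<psi> s)) s = expect \<Omega> w S f (\<psi> s)"
  using assms(1,6)
proof (induction S arbitrary: s rule: finite_induct)
  case (insert i S)
  have "expect \<Omega>' w' (insert i S) (\<lambda>s. f (\<psi> s)) s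
      = (\<Sum>b\<in>\<Omega>'. w' b * expect \<Omega> w S f ((\<psi> s)(i := \<pi> b)))"
    using insert.hyps insert.IH[OF insert.prems] insert.prems[of i]
    by (simp add: expect_insert avg_def del: fun_upd_apply)
  also have "\<dots> = (\<Sum>a\<in>\<Omega>. \<Sum>b\<in>{b\<in>\<Omega>'. \<pi> b = a}. w' b * expect \<Omega> w S f ((\<psi> s)(i := \<pi> b)))"
    using sum.group[OF assms(2,3,4)] by (rule sym)
  also have "\<dots> = (\<Sum>a\<in>\<Omega>. (\<Sum>b\<in>{b\<in>\<Omega>'. \<pi> b = a}. w' b) * expect \<Omega> w S f ((\<psi> s)(i := a)))"
    by (simp add: sum_distrib_right)
  also have "\<dots> = expect \<Omega> w (insert i S) f (\<psi> s)"
    using insert by (simp add: expect_insert avg_def assms(5))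
  finally show ?case .
qed simp

section \<open>Conditional expectations as orthogonal projections\<close>

locale finite_prob =
  fixes \<Omega> :: "'a set" and w :: "'a \<Rightarrow> real"
  assumes fin: "finite \<Omega>" and nonneg: "\<And>a. a \<in> \<Omega> \<Longrightarrow> w a \<ge> 0" and total: "(\<Sum>a\<in>\<Omega>. w a) = 1"
begin

abbreviation "A \<equiv> avg \<Omega> w"
abbreviation "E \<equiv> expect \<Omega> w"

lemma avg_upd [simp]: "A i f (x(i := a)) = A i f x"
  by (simp add: avg_def)

text \<open>\<open>A i f\<close> is constant in coordinate \<open>i\<close>, hence acts as a scalar
  there.\<close>

lemma avg_mult: "A i (\<lambda>x. A i f x * g x) = (\<lambda>x. A i f x * A i g x)"
proof
  show "A i (\<lambda>x. A i f x * g x) x = A i f x * A i g x" for x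
    unfolding avg_def[of \<Omega> w i "\<lambda>x. A i f x * g x"] avg_def[of \<Omega> w i g] avg_upd
    by (simp add: sum_distrib_left mult_ac)
qed

lemma avg_const [simp]: "A i (\<lambda>x. c) = (\<lambda>x. c)"
  using total by (simp add: avg_def fun_eq_iff flip: sum_distrib_right)

lemma avg_idem [simp]: "A i (A i f) = A i f"
  using avg_mult[of i f "\<lambda>_. 1"] by simp

lemma expect_const [simp]:
  assumes "finite S" shows "E S (\<lambda>x. c) = (\<lambda>x. c)"
  using assms by (induction S rule: finite_induct) (simp_all add: expect_insert)

lemma avg_expect_commute:
  assumes "finite S" shows "A i (E S f) = E S (A i f)"
  using assms
proof (induction S rule: finite_induct)
  case (insert k S)
  then show ?case by (simp add: expect_insert avg_commute[of \<Omega> w i k])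
qed simp

lemma expect_avg:
  assumes "finite S" "i \<in> S" shows "E S (A i f) = E S f"
proof -
  have S: "S = insert i (S - {i})" using assms by auto
  have "E S (A i f) = A i (E (S - {i}) (A i f))"
    using assms by (subst S, subst expect_insert) auto
  also have "\<dots> = A i (E (S - {i}) f)"
    using assms by (simp add: avg_expect_commute[symmetric])
  also have "\<dots> = E S f"
    using assms by (subst (2) S, subst expect_insert) auto
  finally show ?thesis .
qed

lemma expect_expect:
  assumes "finite S" "R \<subseteq> S" shows "E S (E R f) = E S f"
proof -
  have "finite R" using assms finite_subset by blast
  then show ?thesis using assms(2)
  proof (induction R rule: finite_induct)
    case (insert i R)
    then show ?case using assms(1) by (simp add: expect_insert expect_avg)
  qed simp
qed

lemma abs_expect_le:
  assumes "finite S" shows "\<bar>E S f x\<bar> \<le> E S (\<lambda>x. \<bar>f x\<bar>) x"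
proof -
  have "E S f x \<le> E S (\<lambda>x. \<bar>f x\<bar>) x"
    using assms nonneg by (intro expect_mono) auto
  moreover have "E S (\<lambda>x. (-1) * f x) x \<le> E S (\<lambda>x. \<bar>f x\<bar>) x"
    using assms nonneg by (intro expect_mono) auto
  ultimately show ?thesis
    unfolding expect_cmult[OF assms] by simp
qed

lemma expect_nonneg:
  assumes "finite S" "\<And>x. f x \<ge> 0" shows "E S f x \<ge> 0"
  using expect_mono[of S \<Omega> w "\<lambda>_. 0" f x] assms nonneg by simp

lemma expect_le_const:
  assumes "finite S" "\<And>x. f x \<le> c" shows "E S f x \<le> c"
  using expect_mono[of S \<Omega> w f "\<lambda>_. c" x] assms nonneg by simp

lemma expect_Cauchy_Schwarz:
  assumes S: "finite S"
  shows "E S (\<lambda>x. f x * g x) x \<le> sqrt (E S (\<lambda>x. (f x)\<^sup>2) x) * sqrt (E S (\<lambda>x. (g x)\<^sup>2) x)"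
proof -
  define a b c where "a = E S (\<lambda>x. (f x)\<^sup>2) x" and "b = E S (\<lambda>x. (g x)\<^sup>2) x"
    and "c = E S (\<lambda>x. f x * g x) x"
  have quad: "0 \<le> s\<^sup>2 * a + t\<^sup>2 * b - 2 * s * t * c" for s t
  proof -
    have "0 \<le> E S (\<lambda>x. (s * f x - t * g x)\<^sup>2) x"
      using S by (intro expect_nonneg) auto
    also have "(\<lambda>x. (s * f x - t * g x)\<^sup>2) = (\<lambda>x. s\<^sup>2 * (f x)\<^sup>2 + 1 * (t\<^sup>2 * (g x)\<^sup>2 + (- 2 * s * t) * (f x * g x)))"
      by (simp add: fun_eq_iff power2_eq_square algebra_simps)
    finally show ?thesis
      unfolding expect_linear[OF S] a_def b_def c_def by (simp add: algebra_simps)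
  qed
  have ab: "a \<ge> 0" "b \<ge> 0"
    using S by (auto simp: a_def b_def intro!: expect_nonneg)
  have "c\<^sup>2 \<le> a * b"
  proof (cases "b = 0")
    case True
    have "c = 0"
    proof (rule ccontr)
      assume "c \<noteq> 0"
      \<comment> \<open>For \<open>b = 0\<close> the quadratic form is linear in \<open>t\<close>;
        this choice of \<open>t\<close> makes it equal to -1.\<close>
      have "0 \<le> a - 2 * ((a + 1) / (2 * c)) * c"
        using quad[of 1 "(a + 1) / (2 * c)"] True by simp
      then show False using \<open>c \<noteq> 0\<close> by simp
    qed
    then show ?thesis using ab by simp
  next
    case False
    with ab have "b > 0" by simp
    have "0 \<le> b * (a * b - c\<^sup>2)"
      using quad[of b c] by (simp add: power2_eq_square algebra_simps)
    then show ?thesis using \<open>b > 0\<close> by (simp add: zero_le_mult_iff)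
  qed
  then have "\<bar>c\<bar> \<le> sqrt (a * b)" by (simp add: real_le_rsqrt)
  then show ?thesis by (simp add: real_sqrt_mult a_def b_def c_def)
qed

text \<open>Averaging over one coordinate is an orthogonal projection: the cross term vanishes
  because \<open>A i f\<close> can be pulled out of the average.\<close>

lemma avg_Pythagoras:
  "A i (\<lambda>x. (f x)\<^sup>2) x = (A i f x)\<^sup>2 + A i (\<lambda>x. (f x - A i f x)\<^sup>2) x"
proof -
  have "(\<lambda>x. (f x - A i f x)\<^sup>2) = (\<lambda>x. 1 * (f x)\<^sup>2 + 1 * (A i f x * (1 * A i f x + (-2) * f x)))"
    by (simp add: fun_eq_iff power2_eq_square algebra_simps)
  then show ?thesis
    by (simp only: avg_linear avg_mult avg_idem) (simp add: power2_eq_square algebra_simps)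
qed

lemma expect_Pythagoras:
  assumes "finite S" "i \<in> S"
  shows "E S (\<lambda>x. (f x)\<^sup>2) x = E S (\<lambda>x. (A i f x)\<^sup>2) x + E S (\<lambda>x. (f x - A i f x)\<^sup>2) x"
proof -
  have "E S (\<lambda>x. (f x)\<^sup>2) = E S (A i (\<lambda>x. (f x)\<^sup>2))"
    using assms by (simp add: expect_avg)
  also have "A i (\<lambda>x. (f x)\<^sup>2) = (\<lambda>x. (A i f x)\<^sup>2 + A i (\<lambda>x. (f x - A i f x)\<^sup>2) x)"
    by (rule ext) (rule avg_Pythagoras)
  finally show ?thesis
    using assms by (simp add: expect_add expect_avg)
qed

end

section \<open>Log-Sobolev inequality and small influences\<close>

context finite_prob
begin

lemma weighted_variance:
  "(\<Sum>a\<in>\<Omega>. w a * (g a - c)\<^sup>2) = (\<Sum>a\<in>\<Omega>. w a * (g a)\<^sup>2) - 2 * c * (\<Sum>a\<in>\<Omega>. w a * g a) + c\<^sup>2"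
proof -
  have "(\<Sum>a\<in>\<Omega>. w a * (g a - c)\<^sup>2) = (\<Sum>a\<in>\<Omega>. w a * (g a)\<^sup>2 - (2 * c) * (w a * g a) + w a * c\<^sup>2)"
    by (intro sum.cong refl) (simp add: power2_eq_square algebra_simps)
  also have "\<dots> = (\<Sum>a\<in>\<Omega>. w a * (g a)\<^sup>2) - 2 * c * (\<Sum>a\<in>\<Omega>. w a * g a) + (\<Sum>a\<in>\<Omega>. w a) * c\<^sup>2"
    by (simp only: sum.distrib sum_subtractf sum_distrib_left sum_distrib_right)
  finally show ?thesis by (simp add: total)
qed

lemma weighted_square_le:
  "(\<Sum>a\<in>\<Omega>. w a * g a)\<^sup>2 \<le> (\<Sum>a\<in>\<Omega>. w a * (g a)\<^sup>2)"
proof -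
  have "0 \<le> (\<Sum>a\<in>\<Omega>. w a * (g a - (\<Sum>a\<in>\<Omega>. w a * g a))\<^sup>2)"
    by (intro sum_nonneg mult_nonneg_nonneg nonneg) auto
  then show ?thesis
    unfolding weighted_variance by (simp add: power2_eq_square)
qed

text \<open>The bound \<open>ln u \<le> u - 1\<close> reduces entropy to the variance of the squares
  of \<open>G\<close>, divided by \<open>t\<close>. Factoring
  \<open>(G a)\<^sup>2 - c\<^sup>2\<close> turns that into the variance of \<open>G\<close>, at the
  cost of a bound on \<open>(G a + c)\<^sup>2\<close>; since every atom weighs at least
  \<open>\<kappa>\<close>, this is at most \<open>4 * t / \<kappa>\<close>.\<close>

lemma log_Sobolev_one:
  fixes G :: "'a \<Rightarrow> real" and \<kappa> :: real
  assumes \<kappa>: "0 < \<kappa>" "\<And>a. a \<in> \<Omega> \<Longrightarrow> \<kappa> \<le> w a" and G: "\<And>a. G a \<ge> 0"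
  defines "t \<equiv> (\<Sum>a\<in>\<Omega>. w a * (G a)\<^sup>2)" and "c \<equiv> (\<Sum>a\<in>\<Omega>. w a * G a)"
  shows "(\<Sum>a\<in>\<Omega>. w a * ((G a)\<^sup>2 * ln ((G a)\<^sup>2))) \<le> t * ln t + 4 / \<kappa> * (t - c\<^sup>2)"
proof -
  have le_t: "w a * (G a)\<^sup>2 \<le> t" if "a \<in> \<Omega>" for a
    unfolding t_def using that fin nonneg by (intro member_le_sum) auto
  have t0: "t \<ge> 0"
    unfolding t_def by (intro sum_nonneg mult_nonneg_nonneg nonneg) auto
  have ct: "c\<^sup>2 \<le> t"
    unfolding c_def t_def by (rule weighted_square_le)
  have c0: "c \<ge> 0"
    unfolding c_def by (intro sum_nonneg mult_nonneg_nonneg nonneg G)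
  have "\<Omega> \<noteq> {}" using total by auto
  then obtain a0 where a0: "a0 \<in> \<Omega>" by auto
  have "w a0 \<le> 1"
    using member_le_sum[OF a0, of w] nonneg fin total by auto
  with \<kappa>(2)[OF a0] have \<kappa>1: "\<kappa> \<le> 1" by simp
  show ?thesis
  proof (cases "t = 0")
    case True
    have "w a * ((G a)\<^sup>2 * ln ((G a)\<^sup>2)) = 0" if "a \<in> \<Omega>" for a
    proof -
      have "w a > 0" using \<kappa>(1) \<kappa>(2)[OF that] by simp
      then have "(G a)\<^sup>2 \<le> 0" using le_t[OF that] True by (simp add: mult_le_0_iff)
      then show ?thesis by simp
    qed
    then have "(\<Sum>a\<in>\<Omega>. w a * ((G a)\<^sup>2 * ln ((G a)\<^sup>2))) = 0" by (intro sum.neutral ballI)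
    moreover have "c\<^sup>2 = 0" using ct True by (metis order_antisym zero_le_power2)
    ultimately show ?thesis using True by simp
  next
    case False
    with t0 have t: "t > 0" by simp
    have entropy: "x * ln x \<le> x * ln t + (x\<^sup>2 / t - x)" if "x \<ge> 0" for x
    proof (cases "x = 0")
      case False
      with that have x: "x > 0" by simp
      have "x * ln (x / t) \<le> x * (x / t - 1)"
        using x t ln_le_minus_one[of "x / t"] by (intro mult_left_mono) auto
      then show ?thesis using x t by (simp add: ln_div power2_eq_square algebra_simps)
    qed auto
    have "(\<Sum>a\<in>\<Omega>. w a * ((G a)\<^sup>2 * ln ((G a)\<^sup>2)))
        \<le> (\<Sum>a\<in>\<Omega>. w a * ((G a)\<^sup>2 * ln t + (((G a)\<^sup>2)\<^sup>2 / t - (G a)\<^sup>2)))"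
      using nonneg by (intro sum_mono mult_left_mono entropy) auto
    also have "\<dots> = (\<Sum>a\<in>\<Omega>. w a * (G a)\<^sup>2) * ln t
        + ((\<Sum>a\<in>\<Omega>. w a * ((G a)\<^sup>2)\<^sup>2) / t - (\<Sum>a\<in>\<Omega>. w a * (G a)\<^sup>2))"
      by (simp add: algebra_simps sum.distrib sum_subtractf sum_distrib_left sum_divide_distrib)
    also have "\<dots> = t * ln t + ((\<Sum>a\<in>\<Omega>. w a * ((G a)\<^sup>2)\<^sup>2) / t - t)"
      by (simp only: t_def[symmetric])
    also have "(\<Sum>a\<in>\<Omega>. w a * ((G a)\<^sup>2)\<^sup>2) / t - t \<le> 4 / \<kappa> * (t - c\<^sup>2)"
    proof -
      \<comment> \<open>A variance is at most the mean square distance from any constant, here from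
        \<open>c\<^sup>2\<close>.\<close>
      have "(\<Sum>a\<in>\<Omega>. w a * ((G a)\<^sup>2)\<^sup>2) - t\<^sup>2 \<le> (\<Sum>a\<in>\<Omega>. w a * ((G a)\<^sup>2 - c\<^sup>2)\<^sup>2)"
      proof -
        have "0 \<le> (t - c\<^sup>2)\<^sup>2" by simp
        also have "\<dots> = t\<^sup>2 - 2 * c\<^sup>2 * t + (c\<^sup>2)\<^sup>2"
          by (simp add: power2_eq_square algebra_simps)
        finally show ?thesis
          unfolding weighted_variance t_def[symmetric] by simp
      qed
      also have "\<dots> \<le> (\<Sum>a\<in>\<Omega>. (4 * t / \<kappa>) * (w a * (G a - c)\<^sup>2))"
      proof (rule sum_mono)
        fix a assume a: "a \<in> \<Omega>"
        have "\<kappa> * (G a)\<^sup>2 \<le> t"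
          using le_t[OF a] mult_right_mono[OF \<kappa>(2)[OF a], of "(G a)\<^sup>2"] by simp
        then have 1: "(G a)\<^sup>2 \<le> t / \<kappa>" using \<kappa>(1) by (simp add: field_simps)
        have "\<kappa> * c\<^sup>2 \<le> 1 * c\<^sup>2" using \<kappa>1 by (intro mult_right_mono) auto
        then have 2: "c\<^sup>2 \<le> t / \<kappa>" using ct \<kappa>(1) by (simp add: field_simps)
        have "(G a + c)\<^sup>2 \<le> 2 * (G a)\<^sup>2 + 2 * c\<^sup>2"
          using zero_le_power2[of "G a - c"] by (simp add: power2_eq_square algebra_simps)
        also have "\<dots> \<le> 4 * t / \<kappa>" using 1 2 by simp
        finally have "(G a + c)\<^sup>2 \<le> 4 * t / \<kappa>" .
        then have "(G a + c)\<^sup>2 * (w a * (G a - c)\<^sup>2) \<le> (4 * t / \<kappa>) * (w a * (G a - c)\<^sup>2)"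
          using nonneg[OF a] by (intro mult_right_mono) auto
        moreover have "((G a)\<^sup>2 - c\<^sup>2)\<^sup>2 = (G a + c)\<^sup>2 * (G a - c)\<^sup>2"
          by (simp add: power2_eq_square algebra_simps)
        ultimately show "w a * ((G a)\<^sup>2 - c\<^sup>2)\<^sup>2 \<le> (4 * t / \<kappa>) * (w a * (G a - c)\<^sup>2)"
          by (simp add: mult_ac)
      qed
      also have "\<dots> = (4 * t / \<kappa>) * (t - c\<^sup>2)"
        unfolding sum_distrib_left[symmetric] weighted_variance t_def[symmetric] c_def[symmetric]
        by (simp add: power2_eq_square)
      finally show ?thesis using t by (simp add: field_simps power2_eq_square)
    qed
    finally show ?thesis by simp
  qed
qed

text \<open>The Dirichlet form of the dynamics that resamples one coordinate at a time, that is, the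
  sum of all quadratic influences.\<close>

definition energy :: "'i set \<Rightarrow> (('i \<Rightarrow> 'a) \<Rightarrow> real) \<Rightarrow> ('i \<Rightarrow> 'a) \<Rightarrow> real" where
  "energy S g x = (\<Sum>j\<in>S. E S (\<lambda>y. (g y - A j g y)\<^sup>2) x)"

text \<open>Minkowski's inequality: the norm of an average is at most the average of the norms.
  Expanding the square reduces it to Cauchy-Schwarz for each pair of slices.\<close>

lemma norm_avg_le:
  assumes "finite S" "i \<notin> S"
  shows "E S (\<lambda>y. (A i g y)\<^sup>2) x \<le> (\<Sum>a\<in>\<Omega>. w a * sqrt (E S (\<lambda>y. (g y)\<^sup>2) (x(i := a))))\<^sup>2"
proof -
  let ?N = "\<lambda>a. sqrt (E S (\<lambda>y. (g y)\<^sup>2) (x(i := a)))"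
  have "(\<lambda>y. (A i g y)\<^sup>2) = (\<lambda>y. \<Sum>a\<in>\<Omega>. \<Sum>b\<in>\<Omega>. (w a * w b) * (g (y(i := a)) * g (y(i := b))))"
    by (simp add: fun_eq_iff avg_def power2_eq_square sum_product mult_ac)
  then have "E S (\<lambda>y. (A i g y)\<^sup>2) x
      = (\<Sum>a\<in>\<Omega>. \<Sum>b\<in>\<Omega>. (w a * w b) * E S (\<lambda>y. g (y(i := a)) * g (y(i := b))) x)"
    using assms by (simp add: expect_sum expect_cmult)
  also have "\<dots> \<le> (\<Sum>a\<in>\<Omega>. \<Sum>b\<in>\<Omega>. (w a * w b) * (?N a * ?N b))"
    using assms nonneg
    by (intro sum_mono mult_left_mono)
       (auto simp: expect_upd intro: expect_Cauchy_Schwarz)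
  also have "\<dots> = (\<Sum>a\<in>\<Omega>. w a * ?N a)\<^sup>2"
    by (simp add: power2_eq_square sum_product mult_ac)
  finally show ?thesis .
qed

text \<open>Tensorisation by induction on \<open>S\<close>: the induction hypothesis handles each
  slice, and the one-coordinate inequality is applied to the norms \<open>G a\<close> of the slices
  of \<open>g\<close>.\<close>

theorem log_Sobolev:
  fixes \<kappa> :: real
  assumes \<kappa>: "0 < \<kappa>" "\<And>a. a \<in> \<Omega> \<Longrightarrow> \<kappa> \<le> w a" and "finite S"
  shows "E S (\<lambda>y. (g y)\<^sup>2 * ln ((g y)\<^sup>2)) x
    \<le> E S (\<lambda>y. (g y)\<^sup>2) x * ln (E S (\<lambda>y. (g y)\<^sup>2) x) + 4 / \<kappa> * energy S g x"
  using \<open>finite S\<close>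
proof (induction S arbitrary: x rule: finite_induct)
  case empty
  then show ?case by (simp add: energy_def)
next
  case (insert i S)
  let ?sq = "\<lambda>y. (g y)\<^sup>2"
  define G where "G a = sqrt (E S ?sq (x(i := a)))" for a
  have Esq: "E S ?sq (x(i := a)) = (G a)\<^sup>2" for a
    unfolding G_def using insert.hyps expect_nonneg[of S ?sq] by simp
  define t where "t = (\<Sum>a\<in>\<Omega>. w a * (G a)\<^sup>2)"
  have t: "E (insert i S) ?sq x = t"
    using insert.hyps by (simp add: expect_insert avg_def Esq t_def del: fun_upd_apply)
  have "E (insert i S) (\<lambda>y. ?sq y * ln (?sq y)) x
      = (\<Sum>a\<in>\<Omega>. w a * E S (\<lambda>y. ?sq y * ln (?sq y)) (x(i := a)))"
    using insert.hyps by (simp add: expect_insert avg_def)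
  also have "\<dots> \<le> (\<Sum>a\<in>\<Omega>. w a * ((G a)\<^sup>2 * ln ((G a)\<^sup>2) + 4 / \<kappa> * energy S g (x(i := a))))"
    
    using nonneg insert.IH[of "x(i := _)"] by (intro sum_mono mult_left_mono) (auto simp: Esq simp del: fun_upd_apply)
  also have "\<dots> = (\<Sum>a\<in>\<Omega>. w a * ((G a)\<^sup>2 * ln ((G a)\<^sup>2)))
      + 4 / \<kappa> * (\<Sum>a\<in>\<Omega>. w a * energy S g (x(i := a)))"
    by (simp add: algebra_simps sum.distrib sum_distrib_left)
  also have "(\<Sum>a\<in>\<Omega>. w a * ((G a)\<^sup>2 * ln ((G a)\<^sup>2)))
      \<le> t * ln t + 4 / \<kappa> * (t - (\<Sum>a\<in>\<Omega>. w a * G a)\<^sup>2)"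
    unfolding t_def by (rule log_Sobolev_one[OF \<kappa>]) (auto simp: G_def intro: expect_nonneg insert.hyps)
  \<comment> \<open>By Minkowski, the variance of the slice norms is at most the quadratic influence
    of the new coordinate.\<close>
  also have "t - (\<Sum>a\<in>\<Omega>. w a * G a)\<^sup>2 \<le> E (insert i S) (\<lambda>y. (g y - A i g y)\<^sup>2) x"
  proof -
    have "E (insert i S) (\<lambda>y. (A i g y)\<^sup>2) x = E S (\<lambda>y. (A i g y)\<^sup>2) x"
    proof -
      have "A i (\<lambda>y. (A i g y)\<^sup>2) = (\<lambda>y. (A i g y)\<^sup>2)"
        using avg_mult[of i g "A i g"] by (simp add: power2_eq_square)
      then show ?thesis
        using insert.hyps by (simp add: expect_insert avg_expect_commute)
    qed
    also have "\<dots> \<le> (\<Sum>a\<in>\<Omega>. w a * G a)\<^sup>2"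
      unfolding G_def using insert.hyps by (rule norm_avg_le)
    finally show ?thesis
      using expect_Pythagoras[of "insert i S" i g x] insert.hyps t by simp
  qed
  also have "(\<Sum>a\<in>\<Omega>. w a * energy S g (x(i := a))) = (\<Sum>j\<in>S. E (insert i S) (\<lambda>y. (g y - A j g y)\<^sup>2) x)"
    using insert.hyps unfolding energy_def
    by (simp add: expect_insert avg_def[of \<Omega> w i "E S _"] sum_distrib_left del: fun_upd_apply) (rule sum.swap)
  finally have "E (insert i S) (\<lambda>y. ?sq y * ln (?sq y)) x \<le> t * ln t
      + 4 / \<kappa> * E (insert i S) (\<lambda>y. (g y - A i g y)\<^sup>2) x
      + 4 / \<kappa> * (\<Sum>j\<in>S. E (insert i S) (\<lambda>y. (g y - A j g y)\<^sup>2) x)"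
    using \<kappa>(1) by (simp add: divide_right_mono)
  then show ?case
    using insert.hyps unfolding t energy_def by (simp add: algebra_simps)
qed

text \<open>\<open>A r\<close> commutes with every \<open>A j\<close>, so Pythagoras in direction
  \<open>r\<close> splits each difference \<open>g - A j g\<close>. This additivity makes the
  energies telescope when coordinates are averaged out one after another.\<close>

lemma energy_avg:
  assumes "finite S" "r \<in> S"
  shows "energy S g x = energy S (A r g) x + energy S (\<lambda>y. g y - A r g y) x"
  unfolding energy_def sum.distrib[symmetric]
proof (rule sum.cong[OF refl])
  fix j
  define u where "u = (\<lambda>y. g y - A j g y)"
  have 1: "A r u = (\<lambda>y. A r g y - A j (A r g) y)"
    unfolding u_def avg_diff by (simp add: avg_commute[of \<Omega> w r j])
  have 2: "(\<lambda>y. u y - A r u y) = (\<lambda>y. (g y - A r g y) - A j (\<lambda>y. g y - A r g y) y)"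
    unfolding 1 unfolding u_def avg_diff by (simp add: algebra_simps)
  have 3: "(\<lambda>y. (u y)\<^sup>2) = (\<lambda>y. (g y - A j g y)\<^sup>2)"
    unfolding u_def ..
  have 4: "(\<lambda>y. (A r u y)\<^sup>2) = (\<lambda>y. (A r g y - A j (A r g) y)\<^sup>2)"
    unfolding 1 ..
  have 5: "(\<lambda>y. (u y - A r u y)\<^sup>2)
      = (\<lambda>y. ((g y - A r g y) - A j (\<lambda>y. g y - A r g y) y)\<^sup>2)"
    by (rule ext) (simp only: fun_cong[OF 2])
  show "E S (\<lambda>y. (g y - A j g y)\<^sup>2) x = E S (\<lambda>y. (A r g y - A j (A r g) y)\<^sup>2) x
      + E S (\<lambda>y. ((g y - A r g y) - A j (\<lambda>y. g y - A r g y) y)\<^sup>2) x"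
    using expect_Pythagoras[OF assms, of u x] unfolding 3 4 5 .
qed

lemma energy_nonneg: "finite S \<Longrightarrow> energy S g x \<ge> 0"
  unfolding energy_def by (intro sum_nonneg expect_nonneg) auto

text \<open>The log-Sobolev inequality is only strong for functions of small \<open>L\<^sup>1\<close>-norm; it is applied to the
  martingale differences of \<open>f\<close>.\<close>

lemma small_function_bound:
  fixes \<kappa> \<tau> :: real
  assumes \<kappa>: "0 < \<kappa>" "\<And>a. a \<in> \<Omega> \<Longrightarrow> \<kappa> \<le> w a" and S: "finite S"
    and d: "\<And>y. \<bar>d y\<bar> \<le> 1" and \<tau>: "E S (\<lambda>y. \<bar>d y\<bar>) x \<le> \<tau>" "0 < \<tau>"
  shows "E S (\<lambda>y. (d y)\<^sup>2) x * ln (1 / \<tau>) \<le> 4 / \<kappa> * energy S d x + 2 * E S (\<lambda>y. \<bar>d y\<bar>) x"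
proof -
  let ?sq = "\<lambda>y. (d y)\<^sup>2"
  define q where "q = E S ?sq x"
  have q0: "q \<ge> 0" unfolding q_def using S by (intro expect_nonneg) auto
  have sq_le: "?sq y \<le> \<bar>d y\<bar>" for y
    using mult_left_mono[OF d[of y], of "\<bar>d y\<bar>"] by (simp add: power2_eq_square)
  have "q \<le> E S (\<lambda>y. \<bar>d y\<bar>) x"
    unfolding q_def using S nonneg sq_le by (intro expect_mono) auto
  with \<tau> have q\<tau>: "q \<le> \<tau>" by simp
  \<comment> \<open>A lower bound for the entropy term in which only the first power of
    \<open>\<bar>z\<bar>\<close> is lost; it comes from \<open>ln u \<ge> 1 - 1 / u\<close>.\<close>
  have "2 * z\<^sup>2 + - 2 * \<bar>z\<bar> \<le> z\<^sup>2 * ln (z\<^sup>2)" for z :: real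
  proof (cases "z = 0")
    case False
    then have z: "\<bar>z\<bar> > 0" by simp
    have "1 - 1 / \<bar>z\<bar> \<le> ln \<bar>z\<bar>"
      using ln_le_minus_one[of "1 / \<bar>z\<bar>"] z by (simp add: ln_div)
    then have "\<bar>z\<bar>\<^sup>2 * (2 * (1 - 1 / \<bar>z\<bar>)) \<le> \<bar>z\<bar>\<^sup>2 * (2 * ln \<bar>z\<bar>)"
      by (intro mult_left_mono) auto
    moreover have "ln (\<bar>z\<bar>\<^sup>2) = 2 * ln \<bar>z\<bar>" using ln_realpow[of "\<bar>z\<bar>" 2] by simp
    ultimately have "\<bar>z\<bar>\<^sup>2 * (2 * (1 - 1 / \<bar>z\<bar>)) \<le> \<bar>z\<bar>\<^sup>2 * ln (\<bar>z\<bar>\<^sup>2)" by simp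
    moreover have "\<bar>z\<bar>\<^sup>2 * (2 * (1 - 1 / \<bar>z\<bar>)) = 2 * \<bar>z\<bar>\<^sup>2 + - 2 * \<bar>z\<bar>"
      using z by (simp add: field_simps power2_eq_square)
    ultimately show ?thesis by simp
  qed simp
  then have "E S (\<lambda>y. 2 * ?sq y + - 2 * \<bar>d y\<bar>) x \<le> E S (\<lambda>y. ?sq y * ln (?sq y)) x"
    using S nonneg by (intro expect_mono) auto
  also have "\<dots> \<le> q * ln q + 4 / \<kappa> * energy S d x"
    unfolding q_def by (rule log_Sobolev[OF \<kappa> S])
  finally have "2 * q - 2 * E S (\<lambda>y. \<bar>d y\<bar>) x \<le> q * ln q + 4 / \<kappa> * energy S d x"
    unfolding expect_linear[OF S] q_def by simp
  moreover have "q * ln q \<le> - (q * ln (1 / \<tau>))"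
  proof (cases "q = 0")
    case False
    with q0 q\<tau> \<tau>(2) have "ln q \<le> - ln (1 / \<tau>)" by (simp add: ln_div)
    from mult_left_mono[OF this q0] show ?thesis by simp
  qed simp
  ultimately show ?thesis using q0 unfolding q_def by linarith
qed

text \<open>Friedgut's junta theorem in the form of Falik and Samorodnitsky: averaging out coordinates of small
  influence loses little \<open>L\<^sup>2\<close>-norm.\<close>

theorem small_influences:
  fixes \<kappa> \<tau> :: real
  assumes \<kappa>: "0 < \<kappa>" "\<And>a. a \<in> \<Omega> \<Longrightarrow> \<kappa> \<le> w a" and S: "finite S"
    and f: "\<And>y. 0 \<le> f y" "\<And>y. f y \<le> 1" and "0 < \<tau>" and "R \<subseteq> S"
    and "\<And>r. r \<in> R \<Longrightarrow> E S (\<lambda>y. \<bar>f y - A r f y\<bar>) x \<le> \<tau>"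
  shows "(E S (\<lambda>y. (f y)\<^sup>2) x - E S (\<lambda>y. (E R f y)\<^sup>2) x) * ln (1 / \<tau>)
     \<le> 4 / \<kappa> * (energy S f x - energy S (E R f) x) + 2 * (\<Sum>r\<in>R. E S (\<lambda>y. \<bar>f y - A r f y\<bar>) x)"
proof -
  have "finite R" using \<open>R \<subseteq> S\<close> S finite_subset by blast
  then show ?thesis using assms(7,8)
  proof (induction R rule: finite_induct)
    case (insert r R)
    have r: "r \<in> S" and R: "R \<subseteq> S" using insert.prems by auto
    define g where "g = E R f"
    define d where "d = (\<lambda>y. g y - A r g y)"
    have g: "E (insert r R) f = A r g"
      using insert.hyps by (simp add: g_def expect_insert)
    \<comment> \<open>Averages commute, so the martingale difference is an average of
      \<open>f - A r f\<close>; its \<open>L1\<close> norm is therefore bounded by the influence of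
      \<open>r\<close> on the original \<open>f\<close>.\<close>
    have d_eq: "d = E R (\<lambda>y. f y - A r f y)"
      using insert.hyps by (simp add: d_def g_def avg_expect_commute expect_diff)
    have "0 \<le> g y \<and> g y \<le> 1" for y
      using expect_nonneg[of R f] expect_le_const[of R f 1] insert.hyps f by (auto simp: g_def)
    then have "0 \<le> A r g y \<and> A r g y \<le> 1" for y
      using expect_nonneg[of "{r}" g] expect_le_const[of "{r}" g 1] by (auto simp: expect_insert)
    with \<open>\<And>y. 0 \<le> g y \<and> g y \<le> 1\<close> have d1: "\<bar>d y\<bar> \<le> 1" for y
      unfolding d_def by (smt (verit))
    have "E S (\<lambda>y. \<bar>d y\<bar>) x \<le> E S (E R (\<lambda>y. \<bar>f y - A r f y\<bar>)) x"
      unfolding d_eq using S nonneg insert.hyps by (intro expect_mono abs_expect_le) auto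
    also have "\<dots> = E S (\<lambda>y. \<bar>f y - A r f y\<bar>) x"
      using S R by (simp add: expect_expect)
    finally have dle: "E S (\<lambda>y. \<bar>d y\<bar>) x \<le> E S (\<lambda>y. \<bar>f y - A r f y\<bar>) x" .
    then have "E S (\<lambda>y. \<bar>d y\<bar>) x \<le> \<tau>" using insert.prems(2)[of r] by simp
    from small_function_bound[OF \<kappa> S d1 this \<open>0 < \<tau>\<close>] dle
    have "E S (\<lambda>y. (d y)\<^sup>2) x * ln (1 / \<tau>)
        \<le> 4 / \<kappa> * energy S d x + 2 * E S (\<lambda>y. \<bar>f y - A r f y\<bar>) x" by simp
    moreover have "E S (\<lambda>y. (d y)\<^sup>2) x = E S (\<lambda>y. (g y)\<^sup>2) x - E S (\<lambda>y. (A r g y)\<^sup>2) x"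
      using expect_Pythagoras[OF S r, of g x] by (simp add: d_def)
    moreover have "energy S d x = energy S g x - energy S (A r g) x"
      using energy_avg[OF S r, of g x] by (simp add: d_def)
    moreover have "(E S (\<lambda>y. (f y)\<^sup>2) x - E S (\<lambda>y. (g y)\<^sup>2) x) * ln (1 / \<tau>)
      \<le> 4 / \<kappa> * (energy S f x - energy S g x) + 2 * (\<Sum>r\<in>R. E S (\<lambda>y. \<bar>f y - A r f y\<bar>) x)"
      unfolding g_def using insert.prems R by (intro insert.IH) auto
    ultimately show ?case
      using insert.hyps unfolding g by (simp add: algebra_simps)
  qed simp
qed

end

section \<open>Boxes of singletons and pairs\<close>

definition pair_space :: "nat \<Rightarrow> (nat \<times> bool) set" where
  "pair_space m = {0..<m} \<times> UNIV"

definition pair_weight :: "nat \<Rightarrow> real \<Rightarrow> nat \<times> bool \<Rightarrow> real" where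
  "pair_weight m p \<omega> = (if snd \<omega> then p else 1 - p) / real m"

definition pair_weight_deriv :: "nat \<Rightarrow> nat \<times> bool \<Rightarrow> real" where
  "pair_weight_deriv m \<omega> = (if snd \<omega> then 1 else - 1) / real m"

definition pair_set :: "nat \<Rightarrow> nat \<times> bool \<Rightarrow> nat set" where
  "pair_set m \<omega> = (if snd \<omega> then {fst \<omega>, Suc (fst \<omega>) mod m} else {fst \<omega>})"

text \<open>A coordinate with value \<open>(a, False)\<close> is pinned to the letter
  \<open>a\<close>; this is how the coordinates outside the random ones are held fixed.\<close>

definition hit :: "nat \<Rightarrow> ('i \<Rightarrow> nat) set \<Rightarrow> ('i \<Rightarrow> nat \<times> bool) \<Rightarrow> real" where
  "hit m F s = of_bool (\<exists>y\<in>F. \<forall>i. y i \<in> pair_set m (s i))"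

lemma sum_pair_space: "(\<Sum>\<omega>\<in>pair_space m. g \<omega>) = (\<Sum>a<m. g (a, True) + g (a, False))"
proof -
  have "(\<Sum>\<omega>\<in>pair_space m. g \<omega>) = (\<Sum>a\<in>{0..<m}. \<Sum>b\<in>UNIV. g (a, b))"
    unfolding pair_space_def by (subst sum.cartesian_product) simp
  then show ?thesis by (simp add: UNIV_bool atLeast0LessThan add.commute)
qed

lemma finite_prob_pair:
  assumes "m > 0" "0 \<le> p" "p \<le> 1"
  shows "finite_prob (pair_space m) (pair_weight m p)"
proof
  show "finite (pair_space m)" by (simp add: pair_space_def)
  show "0 \<le> pair_weight m p a" for a using assms by (simp add: pair_weight_def)
  show "sum (pair_weight m p) (pair_space m) = 1"
    unfolding sum_pair_space using assms by (simp add: pair_weight_def flip: add_divide_distrib)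
qed

lemma finite_prob_uniform:
  assumes "finite X" "X \<noteq> {}" shows "finite_prob X (\<lambda>_. 1 / real (card X))"
  using assms by unfold_locales auto

lemma hit_01: "hit m F s = 0 \<or> hit m F s = 1"
  by (auto simp: hit_def)

lemma hit_bounds: "0 \<le> hit m F s" "hit m F s \<le> 1"
  by (simp_all add: hit_def)

lemma hit_square: "(hit m F s)\<^sup>2 = hit m F s"
  by (simp add: hit_def)

lemma hit_mono:
  assumes "pair_set m \<omega> \<subseteq> pair_set m \<omega>'"
  shows "hit m F (s(i := \<omega>)) \<le> hit m F (s(i := \<omega>'))"
proof -
  have "\<forall>k. y k \<in> pair_set m ((s(i := \<omega>')) k)" if "\<forall>k. y k \<in> pair_set m ((s(i := \<omega>)) k)" for y
    using that assms by (auto split: if_splits)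
  then show ?thesis unfolding hit_def by (auto simp del: fun_upd_apply)
qed

text \<open>A full turn around the cycle returns to the start, so none of the inequalities can be
  strict.\<close>

lemma decreasing_around_cycle:
  fixes g :: "nat \<Rightarrow> real"
  assumes "\<And>b. b < m \<Longrightarrow> g (Suc b mod m) \<le> g b" "a < m" "b < m"
  shows "g a = g b"
proof -
  have dec: "g c \<le> g a" if "a \<le> c" "c < m" for a c
    using that
  proof (induction c rule: dec_induct)
    case (step n)
    then show ?case using assms(1)[of n] by simp
  qed simp
  have "g 0 \<le> g (m - 1)" using assms(1)[of "m - 1"] assms(2) by simp
  then have "g a \<le> g b" if "a < m" "b < m" for a b
    using dec[of 0 a] dec[of b "m - 1"] that by fastforce
  with assms(2,3) show ?thesis by (simp add: order_antisym)
qed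

text \<open>Pairs are neighbours in the cycle, so a hitting function that is not constant in the coordinate \<open>i\<close>
  must change between some singleton and a pair containing it.\<close>

lemma influence_le:
  assumes "m > 0" "0 \<le> p" "p \<le> 1"
  defines "A \<equiv> avg (pair_space m) (pair_weight m p)"
  shows "A i (\<lambda>s. \<bar>hit m F s - A i (hit m F) s\<bar>) s
    \<le> real m * avg (pair_space m) (pair_weight_deriv m) i (hit m F) s"
proof -
  interpret finite_prob "pair_space m" "pair_weight m p"
    by (rule finite_prob_pair[OF assms(1-3)])
  define g where "g \<omega> = hit m F (s(i := \<omega>))" for \<omega>
  have g01: "g \<omega> = 0 \<or> g \<omega> = 1" for \<omega>
    unfolding g_def by (rule hit_01)
  have g_sub: "g (a, False) \<le> g (a, True)" "g (Suc a mod m, False) \<le> g (a, True)" for a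
    unfolding g_def by (rule hit_mono; simp add: pair_set_def)+
  have "avg (pair_space m) (pair_weight_deriv m) i (hit m F) s
      = (\<Sum>a<m. (g (a, True) - g (a, False)) / real m)"
    unfolding avg_def sum_pair_space
    by (simp add: pair_weight_deriv_def g_def diff_divide_distrib)
  then have rhs: "real m * avg (pair_space m) (pair_weight_deriv m) i (hit m F) s
      = (\<Sum>a<m. g (a, True) - g (a, False))"
    using assms by (simp flip: sum_divide_distrib)
  have lhs: "A i (\<lambda>s. \<bar>hit m F s - A i (hit m F) s\<bar>) s
      = (\<Sum>\<omega>\<in>pair_space m. pair_weight m p \<omega> * \<bar>g \<omega> - A i (hit m F) s\<bar>)"
    unfolding A_def avg_def[of _ _ i "\<lambda>s. \<bar>hit m F s - avg _ _ i (hit m F) s\<bar>"] avg_upd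
    by (simp add: g_def)
  have Ag: "A i (hit m F) s = (\<Sum>\<omega>\<in>pair_space m. pair_weight m p \<omega> * g \<omega>)"
    by (simp add: A_def avg_def g_def)
  show ?thesis
  proof (cases "\<exists>a<m. g (a, True) \<noteq> g (a, False)")
    \<comment> \<open>If enlarging some singleton changes the value of \<open>g\<close>, the right
      side is at least 1, whereas the left side never exceeds 1.\<close>
    case True
    then obtain a where a: "a < m" "g (a, True) - g (a, False) = 1"
      using g_sub g01 by (metis diff_zero order_antisym_conv zero_le_one)
    have A01: "0 \<le> A i (hit m F) s" "A i (hit m F) s \<le> 1"
      using expect_nonneg[of "{i}" "hit m F" s] expect_le_const[of "{i}" "hit m F" 1 s]
      by (auto simp: A_def expect_insert hit_bounds)
    have "(\<Sum>\<omega>\<in>pair_space m. pair_weight m p \<omega> * \<bar>g \<omega> - A i (hit m F) s\<bar>)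
        \<le> (\<Sum>\<omega>\<in>pair_space m. pair_weight m p \<omega> * 1)"
    proof (intro sum_mono mult_left_mono nonneg)
      show "\<bar>g \<omega> - A i (hit m F) s\<bar> \<le> 1" for \<omega>
        using g01[of \<omega>] A01 by auto
    qed
    also have "\<dots> = 1" using total by simp
    also have "1 \<le> (\<Sum>a<m. g (a, True) - g (a, False))"
      using member_le_sum[of a "{..<m}" "\<lambda>a. g (a, True) - g (a, False)"] a g_sub by auto
    finally show ?thesis unfolding lhs rhs .
  next
    case False
    then have TF: "g (a, True) = g (a, False)" if "a < m" for a using that by blast
    \<comment> \<open>The next singleton is contained in the pair at \<open>b\<close>, which hits no
      more than the singleton at \<open>b\<close>; going around the cycle, \<open>g\<close> is
      constant and both sides vanish.\<close>
    have "g (Suc b mod m, False) \<le> g (b, False)" if "b < m" for b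
      using g_sub(2)[of b] TF[OF that] by simp
    from decreasing_around_cycle[of m "\<lambda>a. g (a, False)", OF this]
    have "\<exists>c. \<forall>a<m. g (a, False) = c"
      using \<open>m > 0\<close> by blast
    then obtain c where c: "\<And>a. a < m \<Longrightarrow> g (a, False) = c" by blast
    have const: "g \<omega> = c" if "\<omega> \<in> pair_space m" for \<omega>
      using that TF c by (cases \<omega>, cases "snd \<omega>") (auto simp: pair_space_def)
    then have "A i (hit m F) s = c"
      unfolding Ag using total by (simp flip: sum_distrib_right)
    then have "(\<Sum>\<omega>\<in>pair_space m. pair_weight m p \<omega> * \<bar>g \<omega> - A i (hit m F) s\<bar>) = 0"
      using const by (intro sum.neutral) auto
    then show ?thesis unfolding lhs rhs using TF by simp
  qed
qed

section \<open>Russo's formula and bounded total influence\<close>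

lemma avg_deriv_nonneg:
  assumes "m > 0" shows "0 \<le> avg (pair_space m) (pair_weight_deriv m) i (hit m F) s"
proof -
  have "hit m F (s(i := (a, False))) \<le> hit m F (s(i := (a, True)))" for a
    by (rule hit_mono) (simp add: pair_set_def)
  then show ?thesis
    unfolding avg_def sum_pair_space
    by (auto simp: pair_weight_deriv_def diff_divide_distrib[symmetric] intro!: sum_nonneg divide_nonneg_nonneg)
qed

lemma pair_weight_has_derivative:
  assumes "m > 0"
  shows "((\<lambda>p. pair_weight m p \<omega>) has_real_derivative pair_weight_deriv m \<omega>) (at p)"
  unfolding pair_weight_def pair_weight_deriv_def
  using assms by (cases "snd \<omega>") (auto intro!: derivative_eq_intros)

text \<open>Only the flag moves with \<open>p\<close>, so each summand is the expected gain from
  enlarging a singleton to a pair at a uniformly random letter.\<close>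

lemma Russo:
  assumes "m > 0" "finite S" "0 \<le> p" "p \<le> 1"
  shows "((\<lambda>p. expect (pair_space m) (pair_weight m p) S (hit m F) s) has_real_derivative
    (\<Sum>i\<in>S. expect (pair_space m) (pair_weight m p) S
      (avg (pair_space m) (pair_weight_deriv m) i (hit m F)) s)) (at p)"
proof -
  interpret finite_prob "pair_space m" "pair_weight m p"
    by (rule finite_prob_pair[OF assms(1,3,4)])
  show ?thesis
    by (rule expect_derivative) (auto simp: assms total pair_weight_has_derivative)
qed

text \<open>The parameter \<open>p\<close> varies over an interval of length
  \<open>1 / (2 * (h + 1))\<close>, so the mean value theorem gives a derivative of at most
  \<open>2 * (h + 1)\<close>; \<open>influence_le\<close> costs the factor \<open>m\<close>.\<close>

definition total_influence_bound :: "nat \<Rightarrow> nat \<Rightarrow> real" where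
  "total_influence_bound h m = 2 * real m * (real h + 1)"

text \<open>Chosen so that the bound in \<open>small_influences\<close> becomes \<open>\<delta> / (2 (h + 1))\<close>, which leaves room for a union
  bound over \<open>h\<close> families.\<close>

definition influence_threshold :: "nat \<Rightarrow> nat \<Rightarrow> real \<Rightarrow> real" where
  "influence_threshold h m \<delta> = exp (- (2 * (real h + 1) *
     (8 * real m * (real h + 1) + 2) * total_influence_bound h m / \<delta>))"

text \<open>By Markov's inequality, this bounds the number of coordinates whose influence exceeds
  the threshold.\<close>

definition robustness :: "nat \<Rightarrow> nat \<Rightarrow> real \<Rightarrow> nat" where
  "robustness h m \<delta> = nat \<lceil>total_influence_bound h m / influence_threshold h m \<delta>\<rceil>"

text \<open>Values of \<open>y\<close> on \<open>S - L\<close> are averaged out, so \<open>y\<close>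
  only encodes the letters fixed on \<open>L\<close>, while \<open>x\<close> fixes everything
  outside \<open>S\<close>.\<close>

definition robust :: "nat \<Rightarrow> nat \<Rightarrow> real \<Rightarrow> 'i set \<Rightarrow> ('i \<Rightarrow> nat) set \<Rightarrow> ('i \<Rightarrow> nat) \<Rightarrow> bool" where
  "robust m r \<delta> S F x \<longleftrightarrow> (\<forall>L y. L \<subseteq> S \<longrightarrow> card L \<le> r \<longrightarrow> (\<forall>i. i \<notin> S \<longrightarrow> y i = x i) \<longrightarrow>
     (\<forall>i\<in>S. y i < m) \<longrightarrow> \<delta> \<le> expect {0..<m} (\<lambda>_. 1 / real m) (S - L) (indicator F) y)"

text \<open>Let \<open>G\<close> be the hitting function with its low-influence coordinates averaged
  out. Robustness gives \<open>\<delta> \<le> G\<close>, hence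
  \<open>\<delta> * (1 - G) \<le> G * (1 - G)\<close>. The mean of \<open>G * (1 - G)\<close> is the
  \<open>L2\<close> loss bounded by \<open>small_influences\<close>, so the mean of
  \<open>1 - G\<close> is small. This happens at some intermediate \<open>p\<close>; monotonicity
  carries it to the right end of the interval.\<close>

theorem hit_large:
  fixes \<delta> :: real
  assumes "h > 0" "m > 0" "finite S" "\<delta> > 0" and rob: "robust m (robustness h m \<delta>) \<delta> S F x"
  shows "1 - 1 / (2 * (real h + 1))
    \<le> expect (pair_space m) (pair_weight m (1 / (real h + 1))) S (hit m F) (\<lambda>i. (x i, False))"
proof -
  \<comment> \<open>\<open>p1\<close> is the probability of a pair in the coupling by arcs; starting
    from half of it keeps all atom weights away from 0.\<close>
  define p0 p1 where "p0 = 1 / (2 * (real h + 1))" and "p1 = 1 / (real h + 1)"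
  define s0 where "s0 = (\<lambda>i. (x i, False))"
  define \<mu> where "\<mu> p = expect (pair_space m) (pair_weight m p) S (hit m F) s0" for p
  define D where "D p = (\<Sum>i\<in>S. expect (pair_space m) (pair_weight m p) S
      (avg (pair_space m) (pair_weight_deriv m) i (hit m F)) s0)" for p
  have p01: "0 < p0" "p0 < p1" "p1 \<le> 1 / 2" "p1 - p0 = p0"
    using \<open>h > 0\<close> by (auto simp: p0_def p1_def field_simps)
  have deriv: "(\<mu> has_real_derivative D p) (at p)" if "0 \<le> p" "p \<le> 1" for p
    unfolding \<mu>_def D_def using Russo[OF \<open>m > 0\<close> \<open>finite S\<close> that] .
  have bounds: "0 \<le> \<mu> p \<and> \<mu> p \<le> 1" if "0 \<le> p" "p \<le> 1" for p
  proof -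
    interpret finite_prob "pair_space m" "pair_weight m p"
      using \<open>m > 0\<close> that by (rule finite_prob_pair)
    show ?thesis unfolding \<mu>_def
      by (intro conjI expect_nonneg expect_le_const hit_bounds \<open>finite S\<close>)
  qed
  have "\<exists>p>p0. p < p1 \<and> \<mu> p1 - \<mu> p0 = (p1 - p0) * D p"
    using p01 by (intro MVT2 deriv) auto
  then obtain p where p: "p0 < p" "p < p1" "\<mu> p1 - \<mu> p0 = (p1 - p0) * D p"
    by blast
  have p': "0 \<le> p" "p \<le> 1" using p p01 by auto
  have "p0 * D p \<le> 1"
    using p(3) p01 bounds[of p1] bounds[of p0] by simp
  then have Dp: "real m * D p \<le> total_influence_bound h m"
    using mult_left_mono[of "D p" "2 * (real h + 1)" "real m"]
    by (simp add: total_influence_bound_def p0_def field_simps)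
  interpret finite_prob "pair_space m" "pair_weight m p"
    using \<open>m > 0\<close> p' by (rule finite_prob_pair)
  have D_nonneg: "0 \<le> D q" if "0 \<le> q" "q \<le> 1" for q
  proof -
    interpret q: finite_prob "pair_space m" "pair_weight m q"
      using \<open>m > 0\<close> that by (rule finite_prob_pair)
    show ?thesis unfolding D_def
      using \<open>finite S\<close> \<open>m > 0\<close> by (intro sum_nonneg q.expect_nonneg avg_deriv_nonneg) auto
  qed
  have "\<mu> p \<le> \<mu> p1"
  proof (rule DERIV_nonneg_imp_nondecreasing[where f = \<mu>])
    show "\<exists>y. (\<mu> has_real_derivative y) (at q) \<and> 0 \<le> y" if "p \<le> q" "q \<le> p1" for q
      using deriv[of q] D_nonneg[of q] that p' p01 by auto
  qed (use p in simp)
  define f where "f = (hit m F :: ('a \<Rightarrow> nat \<times> bool) \<Rightarrow> real)"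
  have f: "0 \<le> f s" "f s \<le> 1" "(f s)\<^sup>2 = f s" for s
    by (simp_all add: f_def hit_bounds hit_square)
  define b where "b r = E S (\<lambda>s. \<bar>f s - A r f s\<bar>) s0" for r
  define \<tau> where "\<tau> = influence_threshold h m \<delta>"
  have \<tau>: "\<tau> > 0" by (simp add: \<tau>_def influence_threshold_def)
  have b_nonneg: "b r \<ge> 0" for r
    unfolding b_def using \<open>finite S\<close> by (intro expect_nonneg) auto
  have b_le: "b r \<le> real m * E S (avg (pair_space m) (pair_weight_deriv m) r f) s0" if "r \<in> S" for r
  proof -
    have "b r = E S (A r (\<lambda>s. \<bar>f s - A r f s\<bar>)) s0"
      unfolding b_def using that \<open>finite S\<close> by (simp add: expect_avg)
    also have "\<dots> \<le> E S (\<lambda>s. real m * avg (pair_space m) (pair_weight_deriv m) r f s) s0"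
      unfolding f_def using \<open>finite S\<close> nonneg influence_le[OF \<open>m > 0\<close> p']
      by (intro expect_mono) auto
    finally show ?thesis using \<open>finite S\<close> by (simp add: expect_cmult)
  qed
  have sum_b: "(\<Sum>r\<in>S. b r) \<le> total_influence_bound h m"
  proof -
    have "(\<Sum>r\<in>S. b r) \<le> real m * D p"
      unfolding D_def sum_distrib_left f_def[symmetric] by (intro sum_mono b_le)
    with Dp show ?thesis by simp
  qed
  define L where "L = {r \<in> S. b r > \<tau>}"
  define R where "R = S - L"
  have L: "L \<subseteq> S" "finite L" and R: "R \<subseteq> S" "finite R" "S - L = R"
    using \<open>finite S\<close> by (auto simp: L_def R_def)
  have "real (card L) * \<tau> \<le> (\<Sum>r\<in>L. b r)"
    using sum_mono[of L "\<lambda>_. \<tau>" b] by (auto simp: L_def)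
  also have "\<dots> \<le> (\<Sum>r\<in>S. b r)"
    using L \<open>finite S\<close> b_nonneg by (intro sum_mono2) auto
  finally have "real (card L) \<le> total_influence_bound h m / \<tau>"
    using sum_b \<tau> by (simp add: field_simps)
  then have card_L: "card L \<le> robustness h m \<delta>"
    unfolding robustness_def \<tau>_def[symmetric] by linarith
  have energy_le: "energy S f s0 \<le> total_influence_bound h m"
  proof -
    have Af: "0 \<le> A r f s \<and> A r f s \<le> 1" for r s
      using expect_nonneg[of "{r}" f s] expect_le_const[of "{r}" f 1 s] f by (auto simp: expect_insert)
    have "(f s - A r f s)\<^sup>2 \<le> \<bar>f s - A r f s\<bar>" for r s
    proof -
      have "\<bar>f s - A r f s\<bar> \<le> 1" using f[of s] Af[of r s] by linarith
      from mult_left_mono[OF this, of "\<bar>f s - A r f s\<bar>"] show ?thesis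
        by (simp add: power2_eq_square)
    qed
    then have "energy S f s0 \<le> (\<Sum>r\<in>S. b r)"
      unfolding energy_def b_def using \<open>finite S\<close> nonneg by (intro sum_mono expect_mono) auto
    with sum_b show ?thesis by simp
  qed
  define \<kappa> where "\<kappa> = p0 / real m"
  \<comment> \<open>Both flags have probability at least \<open>p0\<close>, because
    \<open>p0 < p\<close> and \<open>p < p1 \<le> 1 / 2\<close>.\<close>
  have \<kappa>: "0 < \<kappa>" "\<And>\<omega>. \<kappa> \<le> pair_weight m p \<omega>"
    unfolding \<kappa>_def pair_weight_def using p p01 \<open>m > 0\<close> by (auto intro!: divide_right_mono)
  have \<kappa>4: "4 / \<kappa> = 8 * real m * (real h + 1)"
    by (simp add: \<kappa>_def p0_def field_simps)
  define G where "G = E R f"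
  have "(E S (\<lambda>y. (f y)\<^sup>2) s0 - E S (\<lambda>y. (G y)\<^sup>2) s0) * ln (1 / \<tau>)
      \<le> 4 / \<kappa> * (energy S f s0 - energy S G s0) + 2 * (\<Sum>r\<in>R. b r)"
    unfolding b_def G_def
  proof (rule small_influences)
    show "E S (\<lambda>y. \<bar>f y - A r f y\<bar>) s0 \<le> \<tau>" if "r \<in> R" for r
      using that by (auto simp: R_def L_def b_def)
  qed (use \<kappa> \<open>finite S\<close> f \<tau> R in auto)
  also have "\<dots> \<le> 4 / \<kappa> * total_influence_bound h m + 2 * total_influence_bound h m"
  proof -
    have "(\<Sum>r\<in>R. b r) \<le> (\<Sum>r\<in>S. b r)"
      using R \<open>finite S\<close> b_nonneg by (intro sum_mono2) auto
    moreover have "energy S f s0 - energy S G s0 \<le> total_influence_bound h m"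
      using energy_le energy_nonneg[OF \<open>finite S\<close>, of G s0] by simp
    ultimately show ?thesis
      using sum_b \<kappa>(1) by (intro add_mono mult_left_mono) auto
  qed
  also have "\<dots> = \<delta> / (2 * (real h + 1)) * ln (1 / \<tau>)"
  proof -
    define q where "q = real h + 1"
    define c where "c = (8 * real m * q + 2) * total_influence_bound h m"
    have "q > 0" by (simp add: q_def)
    have "ln (1 / \<tau>) = 2 * q * c / \<delta>"
      unfolding \<tau>_def influence_threshold_def q_def c_def by (simp add: ln_div)
    then have "\<delta> / (2 * q) * ln (1 / \<tau>) = c"
      using \<open>q > 0\<close> \<open>\<delta> > 0\<close> by simp
    then show ?thesis
      unfolding \<kappa>4 q_def[symmetric] by (simp add: c_def algebra_simps)
  qed
  finally have main: "(E S (\<lambda>y. (f y)\<^sup>2) s0 - E S (\<lambda>y. (G y)\<^sup>2) s0) * ln (1 / \<tau>)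
      \<le> \<delta> / (2 * (real h + 1)) * ln (1 / \<tau>)" .
  have "ln (1 / \<tau>) > 0"
  proof -
    have "2 * (real h + 1) * (8 * real m * (real h + 1) + 2) * (2 * real m * (real h + 1)) / \<delta> > 0"
      using \<open>\<delta> > 0\<close> \<open>m > 0\<close>
      by (intro divide_pos_pos mult_pos_pos add_pos_pos add_nonneg_pos) auto
    then show ?thesis
      unfolding \<tau>_def influence_threshold_def total_influence_bound_def by (simp only: ln_div) simp
  qed
  with main have main': "E S (\<lambda>y. (f y)\<^sup>2) s0 - E S (\<lambda>y. (G y)\<^sup>2) s0 \<le> \<delta> / (2 * (real h + 1))"
    by (rule mult_right_le_imp_le)
  \<comment> \<open>Every box contains the point of its first letters. These letters are uniform on
    \<open>R\<close> and fixed on \<open>L\<close>, so robustness applies to the event that this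
    point lies in \<open>F\<close>.\<close>
  have G_ge: "\<delta> \<le> G y" if y: "\<And>i. i \<notin> S \<Longrightarrow> y i = s0 i" "\<And>i. i \<in> S \<Longrightarrow> y i \<in> pair_space m" for y
  proof -
    have "\<delta> \<le> expect {0..<m} (\<lambda>_. 1 / real m) R (indicator F) (fst \<circ> y)"
      using rob L(1) card_L y unfolding robust_def R_def
      by (auto simp: s0_def pair_space_def mem_Times_iff)
    also have "\<dots> = E R (\<lambda>s. indicator F (fst \<circ> s)) y"
    proof (rule expect_pushforward[symmetric])
      show "(\<Sum>b | b \<in> pair_space m \<and> fst b = a. pair_weight m p b) = 1 / real m" if "a \<in> {0..<m}" for a
      proof -
        have "{b. b \<in> pair_space m \<and> fst b = a} = {(a, True), (a, False)}"
          using that by (auto simp: pair_space_def)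
        then show ?thesis by (simp add: pair_weight_def flip: add_divide_distrib)
      qed
    qed (use fin R in \<open>auto simp: pair_space_def\<close>)
    also have "\<dots> \<le> G y"
      unfolding G_def f_def using R nonneg
      by (intro expect_mono) (auto simp: hit_def pair_set_def indicator_def intro!: bexI[of _ "fst \<circ> _"])
    finally show ?thesis .
  qed
  have "E S (\<lambda>y. \<delta> * 1 + (- \<delta>) * G y) s0 \<le> E S (\<lambda>y. 1 * G y + (-1) * (G y)\<^sup>2) s0"
  proof (rule expect_mono_on)
    fix y assume "\<And>i. i \<notin> S \<Longrightarrow> y i = s0 i" "\<And>i. i \<in> S \<Longrightarrow> y i \<in> pair_space m"
    then have "\<delta> \<le> G y" by (rule G_ge)
    moreover have "G y \<le> 1" unfolding G_def using R f by (intro expect_le_const) auto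
    ultimately have "\<delta> * (1 - G y) \<le> G y * (1 - G y)" by (intro mult_right_mono) auto
    then show "\<delta> * 1 + (- \<delta>) * G y \<le> 1 * G y + (-1) * (G y)\<^sup>2"
      by (simp add: power2_eq_square algebra_simps)
  qed (use \<open>finite S\<close> nonneg in auto)
  then have "\<delta> * (1 - E S G s0) \<le> E S G s0 - E S (\<lambda>y. (G y)\<^sup>2) s0"
    unfolding expect_linear[OF \<open>finite S\<close>] using \<open>finite S\<close> by (simp add: algebra_simps)
  moreover have "E S G s0 = \<mu> p"
    unfolding G_def \<mu>_def f_def using \<open>finite S\<close> R by (simp add: expect_expect)
  moreover have "E S (\<lambda>y. (f y)\<^sup>2) s0 = \<mu> p"
    unfolding f(3) by (simp add: \<mu>_def f_def)
  ultimately have "\<delta> * (1 - \<mu> p) \<le> \<delta> * (1 / (2 * (real h + 1)))" using main' by simp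
  then have "1 - \<mu> p \<le> 1 / (2 * (real h + 1))"
    using \<open>\<delta> > 0\<close> mult_le_cancel_left_pos by blast
  with \<open>\<mu> p \<le> \<mu> p1\<close> show ?thesis
    by (simp add: \<mu>_def p1_def s0_def)
qed

section \<open>Coupling disjoint boxes\<close>

lemma expect_base:
  assumes "finite S" "\<And>i. i \<notin> S \<Longrightarrow> s i = s' i"
  shows "expect \<Omega> w S f s = expect \<Omega> w S f s'"
  using assms
proof (induction S arbitrary: s s' rule: finite_induct)
  case empty
  then have "s = s'" by auto
  then show ?case by simp
next
  case (insert i S)
  have "expect \<Omega> w S f (s(i := a)) = expect \<Omega> w S f (s'(i := a))" for a
    using insert.prems by (intro insert.IH) auto
  then show ?case
    using insert.hyps by (simp add: expect_insert avg_def)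
qed

lemma add_mod_inj:
  fixes c c' k m :: nat
  assumes "(c + k) mod m = (c' + k) mod m" "c < m" "c' < m"
  shows "c = c'"
  using assms
proof (induction c c' rule: linorder_wlog)
  case (le c c')
  then have "m dvd (c' + k) - (c + k)"
    using mod_eq_dvd_iff_nat[of "c + k" "c' + k" m] by simp
  then have "m dvd c' - c" by simp
  then show ?case using le dvd_imp_le[of m "c' - c"] by fastforce
qed simp

lemma card_shift_preimage:
  fixes a k m :: nat
  assumes "a < m" shows "card {c \<in> {0..<m}. (c + k) mod m = a} = 1"
proof -
  let ?f = "\<lambda>c. (c + k) mod m"
  have inj: "inj_on ?f {0..<m}"
    by (rule inj_onI, rule add_mod_inj[where k = k]) auto
  moreover have "?f ` {0..<m} \<subseteq> {0..<m}" using assms by auto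
  ultimately have surj: "?f ` {0..<m} = {0..<m}"
    by (intro endo_inj_surj) auto
  have "a \<in> ?f ` {0..<m}" unfolding surj using assms by simp
  then obtain c where c: "a = ?f c" "c \<in> {0..<m}" by (rule imageE)
  have "x = c" if "x \<in> {0..<m}" "?f x = a" for x
    using inj_onD[OF inj, of x c] c that by simp
  with c have "{c \<in> {0..<m}. ?f c = a} = {c}" by blast
  then show ?thesis by simp
qed

text \<open>With \<open>(c, j\<^sub>0)\<close> uniform in \<open>[m] \<times> {0..h}\<close>, the \<open>h\<close> sets obtained for \<open>j < h\<close> are consecutive arcs of
  the cycle starting at \<open>c\<close>, all singletons except for a pair at position \<open>j\<^sub>0\<close> (if \<open>j\<^sub>0 < h\<close>); they are
  disjoint because \<open>h < m\<close>.\<close>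

definition arc :: "nat \<Rightarrow> nat \<Rightarrow> nat \<times> nat \<Rightarrow> nat \<times> bool" where
  "arc m j \<omega> = ((fst \<omega> + j + of_bool (snd \<omega> < j)) mod m, snd \<omega> = j)"

text \<open>Elements are recorded by their offset \<open>u\<close> from the start \<open>c\<close>:
  the offset is \<open>j\<close> before the pair, \<open>Suc j\<close> after it, and both occur at
  the pair itself.\<close>

lemma arc_elem:
  assumes "v \<in> pair_set m (arc m j (c, j0))"
  shows "\<exists>u. v = (c + u) mod m \<and> (u = j \<and> j \<le> j0 \<or> u = Suc j \<and> j0 \<le> j)"
proof -
  consider "j0 < j" | "j0 = j" | "j < j0" by linarith
  then show ?thesis
  proof cases
    case 1
    with assms have "v = (c + Suc j) mod m" by (simp add: arc_def pair_set_def)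
    with 1 show ?thesis by (intro exI[of _ "Suc j"]) simp
  next
    case 2
    with assms have "v = (c + j) mod m \<or> v = (c + Suc j) mod m"
      by (simp add: arc_def pair_set_def mod_Suc_eq)
    with 2 show ?thesis by blast
  next
    case 3
    with assms have "v = (c + j) mod m" by (simp add: arc_def pair_set_def)
    with 3 show ?thesis by (intro exI[of _ j]) simp
  qed
qed

text \<open>Offsets of a later arc are strictly larger, and all of them are at most
  \<open>h\<close>; since \<open>h < m\<close>, distinct offsets remain distinct modulo
  \<open>m\<close>.\<close>

lemma arc_disjoint:
  assumes "j < j'" "j' < h" "h < m"
  shows "pair_set m (arc m j \<omega>) \<inter> pair_set m (arc m j' \<omega>) = {}"
proof (rule ccontr)
  obtain c j0 where \<omega>: "\<omega> = (c, j0)" by (cases \<omega>)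
  assume "pair_set m (arc m j \<omega>) \<inter> pair_set m (arc m j' \<omega>) \<noteq> {}"
  then obtain v where "v \<in> pair_set m (arc m j (c, j0))" "v \<in> pair_set m (arc m j' (c, j0))"
    unfolding \<omega> by blast
  from arc_elem[OF this(1)] arc_elem[OF this(2)]
  obtain u u' where u: "v = (c + u) mod m" "u = j \<and> j \<le> j0 \<or> u = Suc j \<and> j0 \<le> j"
    and u': "v = (c + u') mod m" "u' = j' \<and> j' \<le> j0 \<or> u' = Suc j' \<and> j0 \<le> j'"
    by (elim exE conjE) (rule that)
  have "u < u'" "u' < m" using u(2) u'(2) assms by auto
  moreover have "(u + c) mod m = (u' + c) mod m" using u(1) u'(1) by (simp only: add.commute)
  ultimately show False
    using add_mod_inj[of u c m u'] by simp
qed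

text \<open>For each \<open>j0\<close> exactly one start \<open>c\<close> gives the prescribed first
  letter, and the flag is set for one of the \<open>h + 1\<close> values of \<open>j0\<close>. Hence
  each family separately has the law required by \<open>hit_large\<close>.\<close>

lemma arc_weight:
  assumes "j < h" "m > 0" "\<omega> \<in> pair_space m"
  shows "(\<Sum>b\<in>{b \<in> {0..<m} \<times> {0..h}. arc m j b = \<omega>}. 1 / real (card ({0..<m} \<times> {0..h})))
    = pair_weight m (1 / (real h + 1)) \<omega>"
proof -
  obtain a b where \<omega>: "\<omega> = (a, b)" "a < m" using assms(3) by (auto simp: pair_space_def)
  define T where "T = {j0 \<in> {0..h}. (j0 = j) = b}"
  have "{\<beta> \<in> {0..<m} \<times> {0..h}. arc m j \<beta> = \<omega>}
      = (\<lambda>(j0, c). (c, j0)) ` (SIGMA j0:T. {c \<in> {0..<m}. (c + (j + of_bool (j0 < j))) mod m = a})"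
    by (auto simp: arc_def \<omega>(1) T_def add.assoc image_iff)
  then have "card {\<beta> \<in> {0..<m} \<times> {0..h}. arc m j \<beta> = \<omega>}
      = card (SIGMA j0:T. {c \<in> {0..<m}. (c + (j + of_bool (j0 < j))) mod m = a})"
    by (simp add: card_image inj_on_def split: prod.splits)
  also have "\<dots> = (\<Sum>j0\<in>T. card {c \<in> {0..<m}. (c + (j + of_bool (j0 < j))) mod m = a})"
    by (rule card_SigmaI) (auto simp: T_def)
  also have "\<dots> = card T"
    unfolding card_shift_preimage[OF \<omega>(2)] by simp
  also have "card T = (if b then 1 else h)"
  proof (cases b)
    case True
    then have "T = {j}" using assms(1) by (auto simp: T_def)
    then show ?thesis using True by simp
  next
    case False
    then have "T = {0..h} - {j}" by (auto simp: T_def)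
    then show ?thesis using False assms(1) by simp
  qed
  finally have "card {\<beta> \<in> {0..<m} \<times> {0..h}. arc m j \<beta> = \<omega>} = (if b then 1 else h)" .
  moreover have "1 - 1 / (real h + 1) = real h / (real h + 1)"
    by (simp add: field_simps)
  ultimately show ?thesis
    by (simp add: \<omega>(1) pair_weight_def mult.commute add.commute distrib_left)
qed

text \<open>All \<open>h\<close> boxes are read off one random point. Each misses \<open>F\<close>
  with probability at most \<open>1 / (2 * (h + 1))\<close>, so some outcome makes all of them hit;
  disjointness of the arcs makes the chosen points differ throughout \<open>S\<close>.\<close>

theorem pairwise_different_representatives:
  fixes \<delta> :: real and x :: "nat \<Rightarrow> 'i \<Rightarrow> nat"
  assumes "h > 0" "h < m" "finite S" "\<delta> > 0"
    and rob: "\<And>j. j < h \<Longrightarrow> robust m (robustness h m \<delta>) \<delta> S F (x j)"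
  obtains y where "\<And>j. j < h \<Longrightarrow> y j \<in> F" "\<And>j i. j < h \<Longrightarrow> i \<notin> S \<Longrightarrow> y j i = x j i"
    "\<And>j j' i. j < h \<Longrightarrow> j' < h \<Longrightarrow> j \<noteq> j' \<Longrightarrow> i \<in> S \<Longrightarrow> y j i \<noteq> y j' i"
proof -
  define \<Omega> where "\<Omega> = {0..<m} \<times> {0..h}"
  have "m > 0" using assms by simp
  interpret finite_prob \<Omega> "\<lambda>_. 1 / real (card \<Omega>)"
    by (rule finite_prob_uniform) (use \<open>m > 0\<close> in \<open>auto simp: \<Omega>_def\<close>)
  define \<psi> where "\<psi> j s = (\<lambda>i. if i \<in> S then arc m j (s i) else (x j i, False))" for j and s :: "'i \<Rightarrow> nat \<times> nat"
  define s0 :: "'i \<Rightarrow> nat \<times> nat" where "s0 = (\<lambda>_. (0, 0))"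
  have E_hit: "1 - 1 / (2 * (real h + 1)) \<le> E S (\<lambda>s. hit m F (\<psi> j s)) s0" if "j < h" for j
  proof -
    have "E S (\<lambda>s. hit m F (\<psi> j s)) s0
        = expect (pair_space m) (pair_weight m (1 / (real h + 1))) S (hit m F) (\<psi> j s0)"
    proof (rule expect_pushforward)
      show "arc m j ` \<Omega> \<subseteq> pair_space m"
        using \<open>m > 0\<close> by (auto simp: arc_def pair_space_def)
      show "(\<Sum>b | b \<in> \<Omega> \<and> arc m j b = \<omega>. 1 / real (card \<Omega>)) = pair_weight m (1 / (real h + 1)) \<omega>"
        if "\<omega> \<in> pair_space m" for \<omega>
        unfolding \<Omega>_def using arc_weight[OF \<open>j < h\<close> \<open>m > 0\<close> that] .
      show "\<psi> j (s(i := b)) = (\<psi> j s)(i := arc m j b)" if "i \<in> S" for s i b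
        using that by (auto simp: \<psi>_def)
    qed (use \<open>finite S\<close> in \<open>auto simp: \<Omega>_def pair_space_def\<close>)
    also have "\<dots> = expect (pair_space m) (pair_weight m (1 / (real h + 1))) S (hit m F) (\<lambda>i. (x j i, False))"
      by (rule expect_base[OF \<open>finite S\<close>]) (simp add: \<psi>_def)
    finally show ?thesis
      using hit_large[OF \<open>h > 0\<close> \<open>m > 0\<close> \<open>finite S\<close> \<open>\<delta> > 0\<close> rob[OF that]] by simp
  qed
  have "\<exists>s. (\<forall>i\<in>S. s i \<in> \<Omega>) \<and> (\<forall>j<h. hit m F (\<psi> j s) = 1)"
  proof (rule ccontr)
    assume contra: "\<not> ?thesis"
    \<comment> \<open>Union bound through expectations: the expected number of hits exceeds
      \<open>h - 1\<close>, whereas a miss in every outcome would keep it at \<open>h - 1\<close> or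
      below.\<close>
    have "real h - 1 < real h * (1 - 1 / (2 * (real h + 1)))"
      by (simp add: field_simps)
    also have "\<dots> = (\<Sum>j<h. 1 - 1 / (2 * (real h + 1)))" by simp
    also have "\<dots> \<le> (\<Sum>j<h. E S (\<lambda>s. hit m F (\<psi> j s)) s0)"
      by (intro sum_mono E_hit) simp
    also have "\<dots> = E S (\<lambda>s. \<Sum>j<h. hit m F (\<psi> j s)) s0"
      by (simp add: expect_sum[OF \<open>finite S\<close>])
    also have "\<dots> \<le> E S (\<lambda>s. real h - 1) s0"
    proof (rule expect_mono_on)
      fix s assume "\<And>i. i \<in> S \<Longrightarrow> s i \<in> \<Omega>"
      then obtain j where j: "j < h" "hit m F (\<psi> j s) \<noteq> 1" using contra by blast
      then have 0: "hit m F (\<psi> j s) = 0" using hit_01 by blast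
      have "(\<Sum>k<h. hit m F (\<psi> k s)) = (\<Sum>k\<in>{..<h} - {j}. hit m F (\<psi> k s))"
        using j(1) 0 by (simp add: sum.remove[of "{..<h}" j])
      also have "\<dots> \<le> (\<Sum>k\<in>{..<h} - {j}. 1)"
        by (intro sum_mono hit_bounds)
      also have "\<dots> = real h - 1" using j(1) by simp
      finally show "(\<Sum>k<h. hit m F (\<psi> k s)) \<le> real h - 1" .
    qed (use \<open>finite S\<close> in auto)
    also have "\<dots> = real h - 1" using \<open>finite S\<close> by simp
    finally show False by simp
  qed
  then obtain s where s: "\<And>j. j < h \<Longrightarrow> hit m F (\<psi> j s) = 1" by blast
  then have "\<forall>j. \<exists>y. j < h \<longrightarrow> y \<in> F \<and> (\<forall>i. y i \<in> pair_set m (\<psi> j s i))"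
    by (auto simp: hit_def)
  then obtain y where y: "\<And>j. j < h \<Longrightarrow> y j \<in> F" "\<And>j i. j < h \<Longrightarrow> y j i \<in> pair_set m (\<psi> j s i)"
    by metis
  have diff: "y j i \<noteq> y j' i" if "j < j'" "j' < h" "i \<in> S" for j j' i
    using arc_disjoint[OF that(1,2) \<open>h < m\<close>, of "s i"] y(2)[of j i] y(2)[of j' i] that
    by (auto simp: \<psi>_def)
  show thesis
  proof
    show "y j i = x j i" if "j < h" "i \<notin> S" for j i
      using y(2)[OF that(1), of i] that(2) by (simp add: \<psi>_def pair_set_def)
    show "y j i \<noteq> y j' i" if "j < h" "j' < h" "j \<noteq> j'" "i \<in> S" for j j' i
      using diff[of j j' i] diff[of j' j i] that by (metis linorder_neqE_nat)
  qed (use y in auto)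
qed

section \<open>Regularity and the junta\<close>

definition cyl :: "nat \<Rightarrow> nat \<Rightarrow> nat set \<Rightarrow> (nat \<Rightarrow> nat) \<Rightarrow> (nat \<Rightarrow> nat) set" where
  "cyl m n I x = {z \<in> cube m n. \<forall>i\<in>I. z i = x i}"

section \<open>Counting points of subcubes\<close>

lemma finite_cube [simp]: "finite (cube m n)"
  by (simp add: cube_def finite_PiE)

lemma card_cube: "card (cube m n) = m ^ n"
  by (simp add: cube_def card_PiE)

lemma finite_cyl [simp]: "finite (cyl m n I x)"
  by (simp add: cyl_def)

lemma card_cyl:
  assumes "x \<in> cube m n" "I \<subseteq> {0..<n}"
  shows "card (cyl m n I x) = m ^ (n - card I)"
proof -
  let ?R = "{0..<n} - I"
  have "bij_betw (\<lambda>z. restrict z ?R) (cyl m n I x) (PiE ?R (\<lambda>_. {0..<m}))"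
  proof (rule bij_betw_byWitness[where f' = "\<lambda>z i. if i \<in> I then x i else z i"])
    show "\<forall>z\<in>cyl m n I x. (\<lambda>i. if i \<in> I then x i else restrict z ?R i) = z"
      by (auto simp: cyl_def cube_def fun_eq_iff PiE_def extensional_def)
    show "\<forall>z\<in>PiE ?R (\<lambda>_. {0..<m}). restrict (\<lambda>i. if i \<in> I then x i else z i) ?R = z"
      by (auto simp: fun_eq_iff PiE_def extensional_def)
    show "(\<lambda>z. restrict z ?R) ` cyl m n I x \<subseteq> PiE ?R (\<lambda>_. {0..<m})"
      by (auto simp: cyl_def cube_def)
    show "(\<lambda>z i. if i \<in> I then x i else z i) ` PiE ?R (\<lambda>_. {0..<m}) \<subseteq> cyl m n I x"
      using assms by (auto simp: cyl_def cube_def PiE_iff extensional_def)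
  qed
  then have "card (cyl m n I x) = card (PiE ?R (\<lambda>_. {0..<m}))" by (rule bij_betw_same_card)
  also have "\<dots> = m ^ card ?R" by (simp add: card_PiE)
  also have "card ?R = n - card I"
    using assms(2) finite_subset by (subst card_Diff_subset) auto
  finally show ?thesis .
qed

text \<open>Translates averages of the indicator into counting, by slicing \<open>F\<close>
  according to the letter at the new coordinate.\<close>

lemma expect_uniform_card:
  assumes "finite R" "finite F" "m > 0" "\<And>z i. z \<in> F \<Longrightarrow> i \<in> R \<Longrightarrow> z i < m"
  shows "expect {0..<m} (\<lambda>_. 1 / real m) R (indicator F) y * real m ^ card R
    = real (card {z \<in> F. \<forall>i. i \<notin> R \<longrightarrow> z i = y i})"
  using assms(1,4)
proof (induction R arbitrary: y rule: finite_induct)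
  case empty
  have "{z \<in> F. \<forall>i. z i = y i} = (if y \<in> F then {y} else {})" by (auto simp flip: fun_eq_iff)
  then show ?case by simp
next
  case (insert i R)
  define Z where "Z a = {z \<in> F. \<forall>k. k \<notin> R \<longrightarrow> z k = (y(i := a)) k}" for a
  have "{z \<in> F. \<forall>k. k \<notin> insert i R \<longrightarrow> z k = y k} = (\<Union>a\<in>{0..<m}. Z a)"
  proof (intro set_eqI iffI)
    fix z assume z: "z \<in> {z \<in> F. \<forall>k. k \<notin> insert i R \<longrightarrow> z k = y k}"
    then have "z \<in> Z (z i)" "z i < m" using insert.prems by (auto simp: Z_def)
    then show "z \<in> (\<Union>a\<in>{0..<m}. Z a)" by (intro UN_I[of "z i"]) auto
  qed (auto simp: Z_def)
  also have "card \<dots> = (\<Sum>a\<in>{0..<m}. card (Z a))"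
  proof (rule card_UN_disjoint)
    show "\<forall>a\<in>{0..<m}. \<forall>b\<in>{0..<m}. a \<noteq> b \<longrightarrow> Z a \<inter> Z b = {}"
      using \<open>i \<notin> R\<close> by (auto simp: Z_def)
  qed (use assms(2) in \<open>auto simp: Z_def\<close>)
  finally have card: "real (card {z \<in> F. \<forall>k. k \<notin> insert i R \<longrightarrow> z k = y k})
      = (\<Sum>a\<in>{0..<m}. real (card (Z a)))" by simp
  have "expect {0..<m} (\<lambda>_. 1 / real m) R (indicator F) (y(i := a)) * real m ^ card R = real (card (Z a))" for a
    unfolding Z_def using insert.prems by (intro insert.IH) auto
  then show ?case
    unfolding card using insert.hyps \<open>m > 0\<close>
    by (simp add: expect_insert avg_def sum_distrib_right sum_distrib_left mult_ac del: fun_upd_apply)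
qed

text \<open>The power of \<open>m\<close> is the size of the subcube through \<open>y\<close>, so
  this bounds a density; \<open>y\<close> supplies the letters on \<open>K\<close>.\<close>

definition spread :: "nat \<Rightarrow> nat \<Rightarrow> nat \<Rightarrow> real \<Rightarrow> (nat \<Rightarrow> nat) set \<Rightarrow> nat set \<Rightarrow> (nat \<Rightarrow> nat) \<Rightarrow> bool" where
  "spread m n r \<delta> F I x \<longleftrightarrow> (\<forall>K y. K \<subseteq> {0..<n} - I \<longrightarrow> card K \<le> r \<longrightarrow> y \<in> cyl m n I x \<longrightarrow>
     \<delta> * real m ^ (n - card (I \<union> K)) \<le> real (card (F \<inter> cyl m n (I \<union> K) y)))"

text \<open>Of the \<open>r + l\<close> coordinates that may be fixed, \<open>l\<close> are spent on
  \<open>K0\<close>, later the centre of a configuration; the other \<open>r\<close> serve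
  robustness on the rest.\<close>

lemma spread_imp_robust:
  assumes "F \<subseteq> cube m n" "m > 0" "x \<in> cube m n" "I \<subseteq> {0..<n}" "spread m n (r + l) \<delta> F I x"
    and K0: "K0 \<subseteq> {0..<n} - I" "card K0 \<le> l"
  shows "robust m r \<delta> ({0..<n} - I - K0) F x"
  unfolding robust_def
proof (intro allI impI)
  fix L y
  let ?S = "{0..<n} - I - K0"
  assume L: "L \<subseteq> ?S" "card L \<le> r" and y: "\<forall>i. i \<notin> ?S \<longrightarrow> y i = x i" "\<forall>i\<in>?S. y i < m"
  let ?K = "K0 \<union> L" let ?R = "?S - L"
  have "x i < m" if "i < n" for i using assms(3) that by (auto simp: cube_def)
  moreover have "x i = undefined" if "\<not> i < n" for i using assms(3) that by (auto simp: cube_def PiE_def extensional_def)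
  ultimately have y_cube: "y \<in> cube m n"
    using y by (fastforce simp: cube_def PiE_iff extensional_def)
  have "y \<in> cyl m n I x" using y y_cube by (auto simp: cyl_def)
  moreover have "?K \<subseteq> {0..<n} - I" using K0 L by auto
  moreover have "card ?K \<le> r + l" using card_Un_le[of K0 L] K0 L by linarith
  ultimately have le: "\<delta> * real m ^ (n - card (I \<union> ?K)) \<le> real (card (F \<inter> cyl m n (I \<union> ?K) y))"
    using assms(5) unfolding spread_def by blast
  have IK: "I \<union> ?K \<subseteq> {0..<n}" "?R = {0..<n} - (I \<union> ?K)" using assms(4) K0 L by auto
  then have cardR: "card ?R = n - card (I \<union> ?K)"
    using finite_subset[OF IK(1)] by (simp add: card_Diff_subset)
  have und: "z i = undefined" if "z \<in> cube m n" "\<not> i < n" for z i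
    using that by (auto simp: cube_def PiE_def extensional_def)
  have "F \<inter> cyl m n (I \<union> ?K) y = {z \<in> F. \<forall>i. i \<notin> ?R \<longrightarrow> z i = y i}"
  proof (intro set_eqI iffI)
    fix z assume z: "z \<in> F \<inter> cyl m n (I \<union> ?K) y"
    have "z i = y i" if "i \<notin> ?R" for i
    proof (cases "i < n")
      case True
      then show ?thesis using z that unfolding IK(2) by (auto simp: cyl_def)
    next
      case False
      then show ?thesis using z assms(1) y_cube und[of z i] und[of y i] by auto
    qed
    then show "z \<in> {z \<in> F. \<forall>i. i \<notin> ?R \<longrightarrow> z i = y i}" using z by blast
  next
    fix z assume z: "z \<in> {z \<in> F. \<forall>i. i \<notin> ?R \<longrightarrow> z i = y i}"
    then show "z \<in> F \<inter> cyl m n (I \<union> ?K) y"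
      unfolding IK(2) using assms(1) by (auto simp: cyl_def)
  qed
  moreover have "expect {0..<m} (\<lambda>_. 1 / real m) ?R (indicator F) y * real m ^ card ?R
      = real (card {z \<in> F. \<forall>i. i \<notin> ?R \<longrightarrow> z i = y i})"
  proof (rule expect_uniform_card)
    show "z i < m" if "z \<in> F" "i \<in> ?R" for z i
      using that assms(1) by (auto simp: cube_def PiE_iff)
    show "finite F" using finite_subset[OF assms(1)] by simp
  qed (use \<open>m > 0\<close> in auto)
  ultimately have "\<delta> * real m ^ card ?R \<le> expect {0..<m} (\<lambda>_. 1 / real m) ?R (indicator F) y * real m ^ card ?R"
    using le unfolding cardR by simp
  then show "\<delta> \<le> expect {0..<m} (\<lambda>_. 1 / real m) ?R (indicator F) y"
    using \<open>m > 0\<close> by simp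
qed

text \<open>The discarded region. The middle clause makes \<open>D\<close> a union of cells, a cell
  being a subcube obtained by fixing the coordinates in \<open>I\<close>.\<close>

definition sparse_part :: "nat \<Rightarrow> nat \<Rightarrow> real \<Rightarrow> (nat \<Rightarrow> nat) set \<Rightarrow> nat set \<Rightarrow> (nat \<Rightarrow> nat) set \<Rightarrow> bool" where
  "sparse_part m n \<delta> F I D \<longleftrightarrow> D \<subseteq> cube m n \<and>
     (\<forall>x\<in>cube m n. \<forall>y\<in>cube m n. (\<forall>i\<in>I. x i = y i) \<longrightarrow> x \<in> D \<longrightarrow> y \<in> D) \<and>
     real (card (F \<inter> D)) \<le> \<delta> * real (card D)"

definition bad_part :: "nat \<Rightarrow> nat \<Rightarrow> nat \<Rightarrow> real \<Rightarrow> (nat \<Rightarrow> nat) set \<Rightarrow> nat set \<Rightarrow> (nat \<Rightarrow> nat) set \<Rightarrow> (nat \<Rightarrow> nat) set" where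
  "bad_part m n r \<delta> F I D = {x \<in> cube m n - D. \<not> spread m n r \<delta> F I x}"

text \<open>Each bad cell contains a subcube of density below \<delta> that fixes at most
  \<open>r\<close> further coordinates. Discarding one such subcube per bad cell removes at least
  the fraction \<open>1 / m ^ r\<close> of it, and at most \<open>m ^ card I\<close> cells
  contribute new coordinates.\<close>

lemma sparse_part_extend:
  assumes "m > 0" "F \<subseteq> cube m n" "I \<subseteq> {0..<n}" and D: "sparse_part m n \<delta> F I D"
  obtains I' D' where "I' \<subseteq> {0..<n}" "card I' \<le> card I + m ^ card I * r" "sparse_part m n \<delta> F I' D'"
    "real (card D) + real (card (bad_part m n r \<delta> F I D)) / real m ^ r \<le> real (card D')"
proof -
  define B where "B = bad_part m n r \<delta> F I D"
  \<comment> \<open>Bad cells are indexed by the restriction of their points to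
    \<open>I\<close>.\<close>
  define T where "T = (\<lambda>x. restrict x I) ` B"
  have finI: "finite I" using finite_subset[OF assms(3)] by simp
  have B_cube: "B \<subseteq> cube m n" by (auto simp: B_def bad_part_def)
  have finB: "finite B" using finite_subset[OF B_cube] by simp
  then have finT: "finite T" by (simp add: T_def)
  have finF: "finite F" using finite_subset[OF assms(2)] by simp
  have finD: "finite D" using D finite_subset[of D "cube m n"] by (simp add: sparse_part_def)
  have "x i < m" if "x \<in> B" "i \<in> I" for x i
    using PiE_mem[OF subsetD[OF B_cube[unfolded cube_def] that(1)], of i] that(2) assms(3) by auto
  then have "T \<subseteq> PiE I (\<lambda>_. {0..<m})"
    by (auto simp: T_def)
  then have "card T \<le> card (PiE I (\<lambda>_. {0..<m}))"
    using finI by (intro card_mono finite_PiE) auto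
  then have cardT: "card T \<le> m ^ card I" using finI by (simp add: card_PiE)
  have "\<forall>t\<in>T. \<exists>K y. K \<subseteq> {0..<n} - I \<and> card K \<le> r \<and> y \<in> cube m n - D \<and> restrict y I = t \<and>
      real (card (F \<inter> cyl m n (I \<union> K) y)) < \<delta> * real m ^ (n - card (I \<union> K))"
  proof
    fix t assume "t \<in> T"
    then obtain x where x: "x \<in> cube m n" "x \<notin> D" "\<not> spread m n r \<delta> F I x" "t = restrict x I"
      by (auto simp: T_def B_def bad_part_def)
    from x(3) obtain K y where Ky: "K \<subseteq> {0..<n} - I" "card K \<le> r" "y \<in> cyl m n I x"
      "real (card (F \<inter> cyl m n (I \<union> K) y)) < \<delta> * real m ^ (n - card (I \<union> K))"
      by (auto simp: spread_def not_le)
    \<comment> \<open>\<open>D\<close> is a union of cells, and \<open>y\<close> lies in the cell of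
      \<open>x\<close>.\<close>
    have "y \<notin> D"
      using D x Ky(3) unfolding sparse_part_def cyl_def by auto
    moreover have "restrict y I = t" "y \<in> cube m n"
      using Ky(3) x(4) by (auto simp: cyl_def fun_eq_iff restrict_def)
    ultimately show "\<exists>K y. K \<subseteq> {0..<n} - I \<and> card K \<le> r \<and> y \<in> cube m n - D \<and> restrict y I = t \<and>
      real (card (F \<inter> cyl m n (I \<union> K) y)) < \<delta> * real m ^ (n - card (I \<union> K))"
      using Ky by blast
  qed
  from bchoice[OF this] obtain K where "\<forall>t\<in>T. \<exists>y. K t \<subseteq> {0..<n} - I \<and> card (K t) \<le> r \<and>
      y \<in> cube m n - D \<and> restrict y I = t \<and>
      real (card (F \<inter> cyl m n (I \<union> K t) y)) < \<delta> * real m ^ (n - card (I \<union> K t))" ..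
  from bchoice[OF this] obtain y where Ky: "\<forall>t\<in>T. K t \<subseteq> {0..<n} - I \<and> card (K t) \<le> r \<and>
      y t \<in> cube m n - D \<and> restrict (y t) I = t \<and>
      real (card (F \<inter> cyl m n (I \<union> K t) (y t))) < \<delta> * real m ^ (n - card (I \<union> K t))" ..
  have K: "K t \<subseteq> {0..<n} - I" "card (K t) \<le> r"
    and y: "y t \<in> cube m n" "y t \<notin> D" "restrict (y t) I = t"
    and sparse: "real (card (F \<inter> cyl m n (I \<union> K t) (y t))) < \<delta> * real m ^ (n - card (I \<union> K t))"
    if "t \<in> T" for t
    using bspec[OF Ky that] by simp_all
  define C where "C t = cyl m n (I \<union> K t) (y t)" for t
  define I' where "I' = I \<union> (\<Union>t\<in>T. K t)"
  define D' where "D' = D \<union> (\<Union>t\<in>T. C t)"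
  have finC: "finite (C t)" for t by (simp add: C_def)
  have C_restrict: "restrict z I = t" if "z \<in> C t" "t \<in> T" for z t
  proof -
    have "restrict z I = restrict (y t) I"
      using that(1) by (intro restrict_ext) (auto simp: C_def cyl_def)
    with y(3)[OF that(2)] show ?thesis by simp
  qed
  have C_disj: "C t \<inter> C t' = {}" if "t \<in> T" "t' \<in> T" "t \<noteq> t'" for t t'
    using C_restrict that by blast
  have C_D: "C t \<inter> D = {}" if "t \<in> T" for t
  proof -
    have "z \<notin> D" if z: "z \<in> C t" for z
    proof
      assume "z \<in> D"
      moreover have "\<forall>i\<in>I. z i = y t i" "z \<in> cube m n" using z by (auto simp: C_def cyl_def)
      ultimately have "y t \<in> D"
        using D y(1)[OF \<open>t \<in> T\<close>] unfolding sparse_part_def by blast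
      with y(2)[OF \<open>t \<in> T\<close>] show False by simp
    qed
    then show ?thesis by blast
  qed
  have IK: "I \<union> K t \<subseteq> {0..<n}" if "t \<in> T" for t using K(1)[OF that] assms(3) by auto
  have cardC: "card (C t) = m ^ (n - card (I \<union> K t))" if "t \<in> T" for t
    unfolding C_def by (rule card_cyl[OF y(1)[OF that] IK[OF that]])
  have cardD': "card D' = card D + (\<Sum>t\<in>T. card (C t))"
  proof -
    have "D \<inter> (\<Union>t\<in>T. C t) = {}" using C_D by blast
    then have "card D' = card D + card (\<Union>t\<in>T. C t)"
      unfolding D'_def using finD finT finC by (intro card_Un_disjoint) auto
    also have "card (\<Union>t\<in>T. C t) = (\<Sum>t\<in>T. card (C t))"
      using finT finC C_disj by (intro card_UN_disjoint) auto
    finally show ?thesis .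
  qed
  have "F \<inter> D' = (F \<inter> D) \<union> (\<Union>t\<in>T. F \<inter> C t)" by (auto simp: D'_def)
  also have "card \<dots> = card (F \<inter> D) + card (\<Union>t\<in>T. F \<inter> C t)"
    using finD finT finC C_D by (intro card_Un_disjoint) auto
  also have "card (\<Union>t\<in>T. F \<inter> C t) = (\<Sum>t\<in>T. card (F \<inter> C t))"
    using finT finC C_disj by (intro card_UN_disjoint) auto
  finally have "real (card (F \<inter> D')) = real (card (F \<inter> D)) + (\<Sum>t\<in>T. real (card (F \<inter> C t)))" by simp
  also have "\<dots> \<le> \<delta> * real (card D) + (\<Sum>t\<in>T. \<delta> * real (card (C t)))"
  proof (intro add_mono sum_mono)
    show "real (card (F \<inter> D)) \<le> \<delta> * real (card D)" using D by (simp add: sparse_part_def)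
    show "real (card (F \<inter> C t)) \<le> \<delta> * real (card (C t))" if "t \<in> T" for t
      using sparse[OF that] cardC[OF that] by (simp add: C_def)
  qed
  also have "\<dots> = \<delta> * real (card D')"
    by (simp add: cardD' sum_distrib_left algebra_simps)
  finally have sparseD': "real (card (F \<inter> D')) \<le> \<delta> * real (card D')" .
  have "sparse_part m n \<delta> F I' D'"
    unfolding sparse_part_def
  proof (intro conjI ballI impI)
    show "D' \<subseteq> cube m n" using D by (auto simp: D'_def C_def cyl_def sparse_part_def)
    fix x z assume xz: "x \<in> cube m n" "z \<in> cube m n" "\<forall>i\<in>I'. x i = z i" "x \<in> D'"
    show "z \<in> D'"
    proof (cases "x \<in> D")
      case True
      have "\<forall>i\<in>I. x i = z i" using xz(3) by (simp add: I'_def)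
      then have "z \<in> D" using D xz True unfolding sparse_part_def by blast
      then show ?thesis by (simp add: D'_def)
    next
      case False
      then obtain t where t: "t \<in> T" "x \<in> C t" using xz(4) by (auto simp: D'_def)
      have "z i = y t i" if "i \<in> I \<union> K t" for i
      proof -
        have "x i = z i" using xz(3) t(1) that by (auto simp: I'_def)
        moreover have "x i = y t i" using t(2) that by (simp add: C_def cyl_def)
        ultimately show ?thesis by simp
      qed
      then have "z \<in> C t" using xz(2) by (simp add: C_def cyl_def)
      then show ?thesis using t by (auto simp: D'_def)
    qed
  qed (rule sparseD')
  moreover have "I' \<subseteq> {0..<n}" using IK assms(3) by (auto simp: I'_def)
  moreover have "card I' \<le> card I + m ^ card I * r"
  proof -
    have "card (\<Union>t\<in>T. K t) \<le> (\<Sum>t\<in>T. card (K t))" by (rule card_UN_le[OF finT])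
    also have "\<dots> \<le> card T * r" using sum_bounded_above[of T "\<lambda>t. card (K t)" r] K(2) by simp
    also have "\<dots> \<le> m ^ card I * r" using cardT by simp
    finally show ?thesis unfolding I'_def using card_Un_le[of I "\<Union>t\<in>T. K t"] by linarith
  qed
  moreover have "real (card D) + real (card B) / real m ^ r \<le> real (card D')"
  proof -
    have "B \<subseteq> (\<Union>t\<in>T. cyl m n I (y t))"
    proof
      fix x assume x: "x \<in> B"
      define t where "t = restrict x I"
      have t: "t \<in> T" using x by (simp add: T_def t_def)
      have "x i = y t i" if "i \<in> I" for i
        using fun_cong[OF y(3)[OF t], of i] that by (simp add: t_def)
      then show "x \<in> (\<Union>t\<in>T. cyl m n I (y t))" using t x B_cube by (auto simp: cyl_def)
    qed
    then have "card B \<le> card (\<Union>t\<in>T. cyl m n I (y t))"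
      using finT by (intro card_mono) auto
    also have "\<dots> \<le> (\<Sum>t\<in>T. card (cyl m n I (y t)))" by (rule card_UN_le[OF finT])
    also have "\<dots> \<le> (\<Sum>t\<in>T. m ^ r * card (C t))"
    proof (rule sum_mono)
      fix t assume t: "t \<in> T"
      have "card (I \<union> K t) \<le> card I + r"
        using card_Un_le[of I "K t"] K(2)[OF t] by linarith
      \<comment> \<open>A whole cell is at most \<open>m ^ r\<close> times as large as the subcube
        discarded from it.\<close>
      then have "n - card I \<le> r + (n - card (I \<union> K t))" by linarith
      then have "m ^ (n - card I) \<le> m ^ (r + (n - card (I \<union> K t)))"
        using \<open>m > 0\<close> by (intro power_increasing) auto
      then show "card (cyl m n I (y t)) \<le> m ^ r * card (C t)"
        by (simp add: card_cyl[OF y(1)[OF t] assms(3)] cardC[OF t] power_add)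
    qed
    finally have "card B \<le> m ^ r * (\<Sum>t\<in>T. card (C t))" by (simp add: sum_distrib_left)
    then have "real (card B) \<le> real m ^ r * real (\<Sum>t\<in>T. card (C t))"
      by (metis of_nat_le_iff of_nat_mult of_nat_power)
    then show ?thesis using \<open>m > 0\<close> unfolding cardD' by (simp add: field_simps)
  qed
  ultimately show thesis unfolding B_def by (intro that)
qed

section \<open>Iterating the regularity step\<close>

fun junta_size :: "nat \<Rightarrow> nat \<Rightarrow> nat \<Rightarrow> nat" where
  "junta_size m r 0 = 0"
| "junta_size m r (Suc t) = junta_size m r t + m ^ junta_size m r t * r"

text \<open>Unless the bad part is already small, each extension enlarges \<open>D\<close> by a
  fixed amount; \<open>junta_size\<close> iterates the bound on the number of coordinates from
  \<open>sparse_part_extend\<close>.\<close>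

lemma regularity_iterate:
  assumes "m > 0" "F \<subseteq> cube m n" "\<delta> > 0"
  shows "\<exists>I D. I \<subseteq> {0..<n} \<and> card I \<le> junta_size m r t \<and> sparse_part m n \<delta> F I D \<and>
    (real (card (bad_part m n r \<delta> F I D)) \<le> \<epsilon> * real m ^ n \<or>
     real t * (\<epsilon> * real m ^ n / real m ^ r) \<le> real (card D))"
proof (induction t)
  case 0
  have "sparse_part m n \<delta> F {} {}" by (simp add: sparse_part_def)
  then show ?case by (intro exI[of _ "{}"]) auto
next
  case (Suc t)
  then obtain I D where I: "I \<subseteq> {0..<n}" "card I \<le> junta_size m r t" and D: "sparse_part m n \<delta> F I D"
    and alt: "real (card (bad_part m n r \<delta> F I D)) \<le> \<epsilon> * real m ^ n \<or>
      real t * (\<epsilon> * real m ^ n / real m ^ r) \<le> real (card D)" by blast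
  show ?case
  proof (cases "real (card (bad_part m n r \<delta> F I D)) \<le> \<epsilon> * real m ^ n")
    case True
    moreover have "card I \<le> junta_size m r (Suc t)" using I(2) by simp
    ultimately show ?thesis using I(1) D by blast
  next
    case False
    obtain I' D' where I': "I' \<subseteq> {0..<n}" "card I' \<le> card I + m ^ card I * r" and D': "sparse_part m n \<delta> F I' D'"
      and ge: "real (card D) + real (card (bad_part m n r \<delta> F I D)) / real m ^ r \<le> real (card D')"
      using sparse_part_extend[OF assms(1,2) I(1) D] .
    have "m ^ card I \<le> m ^ junta_size m r t"
      using I(2) \<open>m > 0\<close> by (intro power_increasing) auto
    then have "m ^ card I * r \<le> m ^ junta_size m r t * r" by (rule mult_le_mono1)
    then have size: "card I' \<le> junta_size m r (Suc t)"
      unfolding junta_size.simps using I'(2) I(2) by linarith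
    have "\<epsilon> * real m ^ n / real m ^ r \<le> real (card (bad_part m n r \<delta> F I D)) / real m ^ r"
      using False by (intro divide_right_mono) auto
    moreover have "real (Suc t) * (\<epsilon> * real m ^ n / real m ^ r)
        = real t * (\<epsilon> * real m ^ n / real m ^ r) + \<epsilon> * real m ^ n / real m ^ r"
      by (simp only: of_nat_Suc distrib_right mult_1 add.commute)
    moreover have "real t * (\<epsilon> * real m ^ n / real m ^ r) \<le> real (card D)"
      using False alt by argo
    ultimately have "real (Suc t) * (\<epsilon> * real m ^ n / real m ^ r) \<le> real (card D')"
      using ge by linarith
    then show ?thesis using I'(1) D' size by blast
  qed
qed

text \<open>\<open>D\<close> has at most \<open>m ^ n\<close> points, so after more than
  \<open>m ^ r / \<epsilon>\<close> rounds the alternative of continued growth is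
  impossible.\<close>

lemma regularity:
  assumes "m > 0" "F \<subseteq> cube m n" "\<delta> > 0" "\<epsilon> > 0"
  obtains I D where "I \<subseteq> {0..<n}" "card I \<le> junta_size m r (Suc (nat \<lceil>real m ^ r / \<epsilon>\<rceil>))"
    "sparse_part m n \<delta> F I D" "real (card (bad_part m n r \<delta> F I D)) \<le> \<epsilon> * real m ^ n"
proof -
  define t where "t = Suc (nat \<lceil>real m ^ r / \<epsilon>\<rceil>)"
  obtain I D where I: "I \<subseteq> {0..<n}" "card I \<le> junta_size m r t" and D: "sparse_part m n \<delta> F I D"
    and alt: "real (card (bad_part m n r \<delta> F I D)) \<le> \<epsilon> * real m ^ n \<or>
      real t * (\<epsilon> * real m ^ n / real m ^ r) \<le> real (card D)"
    using regularity_iterate[OF assms(1-3)] by blast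
  have "card D \<le> m ^ n"
    using D card_mono[of "cube m n" D] by (simp add: sparse_part_def card_cube)
  then have "real (card D) \<le> real m ^ n" by (metis of_nat_le_iff of_nat_power)
  moreover have "real m ^ n < real t * (\<epsilon> * real m ^ n / real m ^ r)"
  proof -
    have "real m ^ r / \<epsilon> < real t" unfolding t_def by linarith
    then have "1 < real t * (\<epsilon> / real m ^ r)" using \<open>\<epsilon> > 0\<close> \<open>m > 0\<close> by (simp add: field_simps)
    then have "1 * real m ^ n < real t * (\<epsilon> / real m ^ r) * real m ^ n"
      using \<open>m > 0\<close> by (intro mult_strict_right_mono) auto
    then show ?thesis by (simp add: mult_ac)
  qed
  ultimately have "real (card (bad_part m n r \<delta> F I D)) \<le> \<epsilon> * real m ^ n"
    using alt by linarith
  then show thesis using I(2) unfolding t_def by (intro that[OF I(1) _ D])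
qed

text \<open>The new points keep the old letters on \<open>I\<close> and on the centre, the image of
  \<open>\<Phi>\<close>, so they inherit the agreements there. At all other coordinates the
  configuration demands pairwise different letters, which the representatives provide.\<close>

lemma contains_config_transfer:
  fixes \<delta> :: real and E :: "nat \<Rightarrow> nat \<Rightarrow> 'v"
  assumes "h < m" "F \<subseteq> cube m n" "\<delta> > 0" "I \<subseteq> {0..<n}" "G \<subseteq> cube m n"
    and spread: "\<And>x. x \<in> G \<Longrightarrow> spread m n (robustness h m \<delta> + l) \<delta> F I x"
    and "contains_config n G l h E"
  shows "contains_config n F l h E"
proof -
  obtain x \<Phi> where x: "\<forall>j<h. x j \<in> G" and \<Phi>: "inj_on \<Phi> {0..<l}" "\<Phi> ` {0..<l} \<subseteq> {0..<n}"
    and agree: "\<forall>j<h. \<forall>j'<h. j \<noteq> j' \<longrightarrow>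
      (\<forall>i<n. (x j i = x j' i) \<longleftrightarrow> (\<exists>k<l. i = \<Phi> k \<and> E j k = E j' k))"
    using assms(7) unfolding contains_config_def by (elim exE conjE) (rule that)
  show ?thesis
  proof (cases "h = 0")
    \<comment> \<open>Without edges only the injection \<open>\<Phi>\<close> is needed; the choice
      of representatives assumes \<open>h > 0\<close>.\<close>
    case True
    then show ?thesis unfolding contains_config_def using \<Phi> by auto
  next
    case False
    define K0 where "K0 = \<Phi> ` {0..<l} - I"
    define S where "S = {0..<n} - I - K0"
    have K0: "K0 \<subseteq> {0..<n} - I" using \<Phi> by (auto simp: K0_def)
    have "card K0 \<le> card (\<Phi> ` {0..<l})" unfolding K0_def by (intro card_mono) auto
    also have "\<dots> \<le> l" using card_image_le[of "{0..<l}" \<Phi>] by simp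
    finally have card_K0: "card K0 \<le> l" .
    have rob: "robust m (robustness h m \<delta>) \<delta> S F (x j)" if "j < h" for j
      unfolding S_def using assms x that K0 card_K0 by (intro spread_imp_robust spread) auto
    obtain y where y: "\<And>j. j < h \<Longrightarrow> y j \<in> F" "\<And>j i. j < h \<Longrightarrow> i \<notin> S \<Longrightarrow> y j i = x j i"
      "\<And>j j' i. j < h \<Longrightarrow> j' < h \<Longrightarrow> j \<noteq> j' \<Longrightarrow> i \<in> S \<Longrightarrow> y j i \<noteq> y j' i"
      using pairwise_different_representatives[of h m S \<delta> F x] False assms(1,3) rob
      by (auto simp: S_def)
    have "(y j i = y j' i) \<longleftrightarrow> (\<exists>k<l. i = \<Phi> k \<and> E j k = E j' k)"
      if "j < h" "j' < h" "j \<noteq> j'" "i < n" for j j' i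
    proof (cases "i \<in> S")
      case True
      then have "i \<notin> \<Phi> ` {0..<l}" by (auto simp: S_def K0_def)
      then show ?thesis using y(3) that True by auto
    next
      case False
      then show ?thesis using y(2) that agree by simp
    qed
    note agree_y = this
    show ?thesis
      unfolding contains_config_def
      by (intro exI[of _ y] exI[of _ \<Phi>] conjI allI impI agree_y y(1) \<Phi>)
  qed
qed

theorem theorem8p1:
  fixes \<eta> :: real and l h m :: nat and E :: "nat \<Rightarrow> nat \<Rightarrow> nat"
  assumes "\<eta> > 0" and "m > h"
  shows "\<exists>J n0 :: nat. \<forall>n \<ge> n0. \<forall>F. F \<subseteq> cube m n \<longrightarrow> config_free n F l h E \<longrightarrow>
           (\<exists>\<J>. \<J> \<subseteq> cube m n \<and> is_junta m n J \<J> \<and> config_free n \<J> l h E \<and>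
                mu m n (F - \<J>) \<le> \<eta>)"
proof -
  \<comment> \<open>Half of \<eta> pays for points of \<open>F\<close> in the sparse region, the
    other half for the bad part.\<close>
  define \<delta> where "\<delta> = \<eta> / 2"
  define r where "r = robustness h m \<delta> + l"
  define J where "J = junta_size m r (Suc (nat \<lceil>real m ^ r / \<delta>\<rceil>))"
  have \<delta>: "\<delta> > 0" using assms by (simp add: \<delta>_def)
  have m: "m > 0" using assms by simp
  have "\<exists>\<J>. \<J> \<subseteq> cube m n \<and> is_junta m n J \<J> \<and> config_free n \<J> l h E \<and> mu m n (F - \<J>) \<le> \<eta>"
    if "n \<ge> J" and F: "F \<subseteq> cube m n" and free: "config_free n F l h E" for n F
  proof -
    obtain I D where I: "I \<subseteq> {0..<n}" "card I \<le> J" and D: "sparse_part m n \<delta> F I D"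
      and bad: "real (card (bad_part m n r \<delta> F I D)) \<le> \<delta> * real m ^ n"
      unfolding J_def using regularity[OF m F \<delta> \<delta>] .
    \<comment> \<open>A junta needs exactly \<open>J\<close> coordinates, so \<open>I\<close> is
      padded; this is why \<open>n \<ge> J\<close> is required.\<close>
    obtain I' where I': "I \<subseteq> I'" "I' \<subseteq> {0..<n}" "card I' = J"
      using exists_subset_between[of I J "{0..<n}"] I \<open>n \<ge> J\<close> by auto
    define G where "G = {x \<in> cube m n - D. spread m n r \<delta> F I x}"
    have D_det: "z \<in> D" if "x \<in> cube m n" "z \<in> cube m n" "\<forall>i\<in>I. x i = z i" "x \<in> D" for x z
      using D that unfolding sparse_part_def by blast
    \<comment> \<open>Both \<open>D\<close> and spreadness depend on a point only through its cell,
      so the union \<open>G\<close> of the remaining spread cells is determined by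
      \<open>I\<close>.\<close>
    have G_det: "z \<in> G" if "x \<in> G" "z \<in> cube m n" "\<forall>i\<in>I. x i = z i" for x z
    proof -
      have "cyl m n I x = cyl m n I z" using that(3) by (auto simp: cyl_def)
      moreover have "z \<notin> D"
        using D_det[of z x] that by (auto simp: G_def)
      ultimately show ?thesis using that by (simp add: G_def spread_def)
    qed
    have "is_junta m n J G"
      unfolding is_junta_def
    proof (intro exI conjI)
      show "(\<lambda>x. restrict x I') ` G \<subseteq> PiE I' (\<lambda>_. {0..<m})"
      proof -
        have "x i < m" if "x \<in> G" "i \<in> I'" for x i
          using that I'(2) PiE_mem[of x "{0..<n}" "\<lambda>_. {0..<m}" i] by (auto simp: G_def cube_def)
        then show ?thesis by auto
      qed
      show "G = {x \<in> cube m n. restrict x I' \<in> (\<lambda>x. restrict x I') ` G}"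
      proof (intro set_eqI iffI)
        fix z assume "z \<in> {x \<in> cube m n. restrict x I' \<in> (\<lambda>x. restrict x I') ` G}"
        then obtain x where x: "x \<in> G" "restrict z I' = restrict x I'" "z \<in> cube m n" by auto
        have "x i = z i" if "i \<in> I" for i
          using fun_cong[OF x(2), of i] that I'(1) by auto
        then show "z \<in> G" using G_det x by blast
      qed (auto simp: G_def)
    qed (use I' in auto)
    moreover have "config_free n G l h E"
      unfolding config_free_def
    proof
      assume G: "contains_config n G l h E"
      have "contains_config n F l h E"
        by (rule contains_config_transfer[OF assms(2) F \<delta> I(1) _ _ G]) (auto simp: G_def r_def)
      with free show False by (simp add: config_free_def)
    qed
    moreover have "mu m n (F - G) \<le> \<eta>"
    proof -
      have "(F - G) \<inter> cube m n \<subseteq> (F \<inter> D) \<union> bad_part m n r \<delta> F I D"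
        by (auto simp: G_def bad_part_def)
      then have "card ((F - G) \<inter> cube m n) \<le> card ((F \<inter> D) \<union> bad_part m n r \<delta> F I D)"
        using D finite_subset[OF _ finite_cube] unfolding sparse_part_def bad_part_def
        by (intro card_mono) auto
      also have "\<dots> \<le> card (F \<inter> D) + card (bad_part m n r \<delta> F I D)" by (rule card_Un_le)
      finally have "real (card ((F - G) \<inter> cube m n)) \<le> real (card (F \<inter> D)) + real (card (bad_part m n r \<delta> F I D))"
        by (metis of_nat_add of_nat_le_iff)
      also have "real (card (F \<inter> D)) \<le> \<delta> * real m ^ n"
      proof -
        have "card D \<le> m ^ n"
          using D card_mono[of "cube m n" D] by (simp add: sparse_part_def card_cube)
        then have "real (card D) \<le> real m ^ n" by (metis of_nat_le_iff of_nat_power)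
        then have "\<delta> * real (card D) \<le> \<delta> * real m ^ n" using \<delta> by simp
        then show ?thesis using D unfolding sparse_part_def by linarith
      qed
      finally have "real (card ((F - G) \<inter> cube m n)) \<le> \<eta> * real m ^ n"
        using bad by (simp add: \<delta>_def)
      then show ?thesis using m by (simp add: mu_def card_cube field_simps)
    qed
    moreover have "G \<subseteq> cube m n" by (auto simp: G_def)
    ultimately show ?thesis by blast
  qed
  then show ?thesis by blast
qed

end
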